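(* Let $n$ be a positive odd integer. Then, modulo $[n]\Phi_{n}(q)^2$, \[ \sum_{k=0}^{(n-1)/2}[6k+1]\frac{(q;q^{4})_{k}(q;q^{2})_{k}^{3}}{(q^{2};q^{2})_{k}(q^{4};q^{4})_{k}^{3}}q^{k^{2}+k} \equiv \begin{cases} \dfrac{(q^{2};q^{4})_{(n-1)/4}}{(q^{4};q^{4})_{(n-1)/4}}[n]\,q^{(1-n)/4}, & \text{if } n\equiv 1 \pmod 4,\\[6pt] 0, & \text{if } n\equiv 3 \pmod 4, \end{cases} \] and, modulo $[n]\Phi_{n}(q)^2$, \[ \sum_{k=0}^{n-1}[6k+1]\frac{(q;q^{4})_{k}(q;q^{2})_{k}^{3}}{(q^{2};q^{2})_{k}(q^{4};q^{4})_{k}^{3}}q^{k^{2}+k} \equiv \begin{cases} \dfrac{(q^{2};q^{4})_{(n-1)/4}}{(q^{4};q^{4})_{(n-1)/4}}[n]\,q^{(1-n)/4}, & \text{if } n\equiv 1 \pmod 4,\\[6pt] 0, & \text{if } n\equiv 3 \pmod 4. \end{cases} \]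
   Context: For an indeterminate $q$, $(a;q)_k=(1-a)(1-aq)\cdots(1-aq^{k-1})$ (with $(a;q)_0=1$) is the $q$-shifted factorial, and $[n]=[n]_q=(1-q^n)/(1-q)$ is the $q$-integer (so $[6k+1]=(1-q^{6k+1})/(1-q)$). $\Phi_n(q)$ denotes the $n$-th cyclotomic polynomial. A congruence $A\equiv B \pmod{P(q)}$ between rational functions in $q$ means that $A-B$ equals $P(q)$ times a rational function whose denominator is coprime to $P(q)$. *)

theory Defs
  imports "HOL-Computational_Algebra.Computational_Algebra"
begin

abbreviation qvar :: "rat poly fract" where
  "qvar \<equiv> to_fract [:0, 1:]"

definition qpoch :: "'a::comm_ring_1 \<Rightarrow> 'a \<Rightarrow> nat \<Rightarrow> 'a" where
  "qpoch a b k = (\<Prod>i<k. 1 - a * b ^ i)"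

definition qint :: "nat \<Rightarrow> rat poly fract" where
  "qint m = (1 - qvar ^ m) / (1 - qvar)"

text \<open>
  The modulus is an element of the field of rational functions that is required to be a
  polynomial, so that \<^term>\<open>qint n\<close> may occur in it.
\<close>

definition ratfun_cong ::
    "rat poly fract \<Rightarrow> rat poly fract \<Rightarrow> rat poly fract \<Rightarrow> bool" where
  "ratfun_cong A B P \<longleftrightarrow>
     (\<exists>p u v. P = to_fract p \<and> v \<noteq> 0 \<and> coprime v p \<and> A - B = P * Fract u v)"

text \<open>
  The recursion comes from $q^n - 1 = \prod_{d \mid n} \Phi_d(q)$; the division is exact for
  $n > 0$, and the lemma \<open>cyclotomic_primitive_roots\<close> below gives the usual product
  over the primitive $n$-th roots of unity.
\<close>

fun cyclotomic :: "nat \<Rightarrow> rat poly" where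
  "cyclotomic n = (monom 1 n - 1) div (\<Prod>d | d dvd n \<and> d < n. cyclotomic d)"

declare cyclotomic.simps [simp del]

definition primitive_roots :: "nat \<Rightarrow> complex set" where
  "primitive_roots n = {z. z ^ n = 1 \<and> (\<forall>m. 0 < m \<and> m < n \<longrightarrow> z ^ m \<noteq> 1)}"

lemma monom_minus_one_roots:
  assumes "n > 0"
  shows "(monom 1 n - 1 :: complex poly) = (\<Prod>z | z ^ n = 1. [:- z, 1:])"
proof -
  let ?p = "monom 1 n - 1 :: complex poly"
  have deg1: "degree (1 :: complex poly) < degree (monom (1::complex) n)"
    using assms by (simp add: degree_monom_eq)
  have lc: "lead_coeff ?p = 1"
    using deg1 lead_coeff_add_le[of "-1" "monom (1::complex) n"]
    by (simp add: degree_monom_eq)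
  have "rsquarefree ?p"
    unfolding rsquarefree_roots using assms
    by (auto simp: pderiv_diff pderiv_monom poly_monom power_0_left)
  from complex_poly_decompose_rsquarefree[OF this] lc show ?thesis
    by (simp add: poly_monom)
qed

lemma roots_of_unity_partition:
  assumes "n > 0"
  shows "{z. z ^ n = 1} = (\<Union>d \<in> {d. d dvd n}. primitive_roots d)"
proof (intro equalityI subsetI)
  fix z :: complex
  assume "z \<in> {z. z ^ n = 1}"
  then have zn: "z ^ n = 1" by simp
  define d where "d = (LEAST d. 0 < d \<and> z ^ d = 1)"
  have d: "0 < d" "z ^ d = 1"
    using LeastI[of "\<lambda>d. 0 < d \<and> z ^ d = 1" n] assms zn by (auto simp: d_def)
  have least: "z ^ m \<noteq> 1" if "0 < m" "m < d" for m
    using not_less_Least[of m "\<lambda>d. 0 < d \<and> z ^ d = 1"] that by (auto simp: d_def)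
  have "z ^ n = z ^ (d * (n div d) + n mod d)" by simp
  also have "\<dots> = z ^ (n mod d)"
    by (simp only: power_add power_mult d power_one mult_1)
  finally have "z ^ (n mod d) = 1" using zn by simp
  moreover have "n mod d < d" using d by simp
  ultimately have "n mod d = 0" using least by blast
  then show "z \<in> (\<Union>d \<in> {d. d dvd n}. primitive_roots d)"
    using d least by (auto simp: primitive_roots_def)
next
  fix z :: complex
  assume "z \<in> (\<Union>d \<in> {d. d dvd n}. primitive_roots d)"
  then obtain d where "d dvd n" and z: "z ^ d = 1"
    by (auto simp: primitive_roots_def)
  then obtain k where "n = d * k"
    by blast
  with z show "z \<in> {z. z ^ n = 1}"
    by (simp add: power_mult)
qed

lemma primitive_roots_disjoint:
  assumes "0 < d" "0 < e" "d \<noteq> e"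
  shows "primitive_roots d \<inter> primitive_roots e = {}"
proof -
  have "d < e \<or> e < d" using assms by linarith
  then show ?thesis
    unfolding primitive_roots_def using assms by blast
qed

lemma finite_primitive_roots: "n > 0 \<Longrightarrow> finite (primitive_roots n)"
  unfolding primitive_roots_def
  by (rule finite_subset[OF _ finite_roots_unity[of n]]) auto

lemma map_poly_of_rat_add:
  "map_poly of_rat (p + r) = map_poly of_rat p + (map_poly of_rat r :: complex poly)"
  by (rule poly_eqI) (simp add: coeff_map_poly of_rat_add)

lemma map_poly_of_rat_mult:
  "map_poly of_rat (p * r) = map_poly of_rat p * (map_poly of_rat r :: complex poly)"
  by (rule poly_eqI) (simp add: coeff_map_poly coeff_mult of_rat_sum of_rat_mult)

lemma map_poly_of_rat_prod:
  "map_poly of_rat (\<Prod>x\<in>A. f x) = (\<Prod>x\<in>A. map_poly of_rat (f x) :: complex poly)"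
  by (induction A rule: infinite_finite_induct) (auto simp: map_poly_of_rat_mult)

lemma cyclotomic_primitive_roots:
  assumes "n > 0"
  shows "map_poly of_rat (cyclotomic n) = (\<Prod>z\<in>primitive_roots n. [:- z, 1:])"
  using assms
proof (induction n rule: less_induct)
  case (less n)
  let ?m = "map_poly of_rat :: rat poly \<Rightarrow> complex poly"
  let ?L = "\<lambda>z::complex. [:- z, 1:]"
  define D where "D = {d. d dvd n \<and> d < n}"
  define Q where "Q = (\<Prod>d\<in>D. cyclotomic d)"
  define P where "P = (monom 1 n - 1 :: rat poly)"
  have D: "finite D" "\<And>d. d \<in> D \<Longrightarrow> 0 < d \<and> d < n" "{d. d dvd n} = insert n D" "n \<notin> D"
  proof -
    show "0 < d \<and> d < n" if "d \<in> D" for d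
      using that less.prems dvd_pos_nat[of n d] by (simp add: D_def)
    show "{d. d dvd n} = insert n D"
      using less.prems dvd_imp_le[of _ n] by (fastforce simp: D_def)
  qed (simp_all add: D_def)
  have Q: "?m Q = (\<Prod>d\<in>D. \<Prod>z\<in>primitive_roots d. ?L z)"
    unfolding Q_def map_poly_of_rat_prod using D(2) less.IH by (intro prod.cong) auto
  have "?m P = monom 1 n - 1"
    by (rule poly_eqI) (auto simp: P_def coeff_map_poly of_rat_diff)
  also have "\<dots> = (\<Prod>z\<in>(\<Union>d\<in>insert n D. primitive_roots d). ?L z)"
    using monom_minus_one_roots[OF less.prems] roots_of_unity_partition[OF less.prems] D(3)
    by simp
  also have "\<dots> = (\<Prod>d\<in>insert n D. \<Prod>z\<in>primitive_roots d. ?L z)"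
    using D less.prems
    by (intro prod.UNION_disjoint ballI impI finite_primitive_roots primitive_roots_disjoint) auto
  also have "\<dots> = ?m Q * (\<Prod>z\<in>primitive_roots n. ?L z)"
    using D by (simp add: Q mult.commute)
  finally have eq: "?m P = ?m Q * (\<Prod>z\<in>primitive_roots n. ?L z)" .
  have Q0: "?m Q \<noteq> 0"
    using D by (auto simp: Q finite_primitive_roots)
  have "P = Q * (P div Q) + P mod Q" by simp
  then have "?m P = ?m (Q * (P div Q) + P mod Q)" by (rule arg_cong)
  then have "?m P = ?m Q * ?m (P div Q) + ?m (P mod Q)"
    by (simp only: map_poly_of_rat_add map_poly_of_rat_mult)
  with eq have eq2: "?m Q * ((\<Prod>z\<in>primitive_roots n. ?L z) - ?m (P div Q)) = ?m (P mod Q)"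
    by (simp add: algebra_simps)
  have deg: "degree (?m r) = degree r" for r
    by (cases "r = 0") (auto intro: map_poly_degree_eq)
  have "(\<Prod>z\<in>primitive_roots n. ?L z) - ?m (P div Q) = 0"
  proof (rule ccontr)
    assume ne: "(\<Prod>z\<in>primitive_roots n. ?L z) - ?m (P div Q) \<noteq> 0"
    then have "degree Q \<le> degree (P mod Q)"
      using degree_mult_eq[OF Q0 ne] unfolding eq2 deg by simp
    moreover have "?m (P mod Q) \<noteq> 0"
      using ne Q0 unfolding eq2[symmetric] by simp
    then have "P mod Q \<noteq> 0" by auto
    ultimately show False
      using degree_mod_less[of Q P] Q0 by force
  qed
  then show ?case
    by (simp add: cyclotomic.simps[of n] P_def Q_def D_def)
qed

end

theory Submission
  imports Defs "HOL-Computational_Algebra.Field_as_Ring" "HOL-Number_Theory.Cong"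
begin

text \<open>
  Introduce a parameter $a$ into the sum, replacing $(q;q^2)_k^2/(q^4;q^4)_k^2$ by
  $(aq,q/a;q^2)_k/(aq^4,q^4/a;q^4)_k$, and call the result $S(a)$. A telescoping certificate gives
  $q(1-aq^3)(1-a)\,S(aq^4) = (1-aq)(1-aq^4)\,S(a)$ up to a boundary term. At $a = q^n$ the sum
  terminates, and the recurrence evaluates it to the right-hand side of the congruence.

  If $q$ is specialised to a primitive $n$-th root of unity, the boundary term of the sum cut off at
  $(n-1)/2$ vanishes for every $a$. Cleared of denominators, $S$ is then a polynomial of degree less
  than $n$ in $a$ satisfying a functional equation, and its value at $a = 1$ is the specialisation
  of $S(q^n)$, which is $0$; this forces it to vanish identically.

  As a function of $x = (1-a)^2/a$ the cleared sum is a polynomial. Between $x = 0$ ($a = 1$) and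
  $x = (1-q^n)^2/q^n$ ($a = q^n$) it changes by a multiple of $\Phi_n(q)^2 \cdot \Phi_n(q)$: one
  factor $\Phi_n^2$ from $x$ and one more $\Phi_n$ from the coefficients. This is the congruence
  modulo $\Phi_n^3$. For a proper divisor $d > 1$ of $n$, the terms with index $jd + r$ are, modulo
  $\Phi_d$, a common factor times the terms with index $r$, so the sum splits into blocks that
  vanish by the case $n = d$.
\<close>

section \<open>A telescoping recurrence in the parameter\<close>

text \<open>The parameter moves by q^4 because the denominators have base q^4: they then change only
  in one end factor each, the numerators of base q^2 only in two. At a = q^n the move sends n to n +
  4, so the class of n modulo 4 is preserved and the two cases of the theorem go back to the
  starting values n = 1 and n = 3. At a primitive n-th root the recurrence alone does not force the
  cleared sum to vanish: for n = 4l + 1 it has a nonzero polynomial solution of degree below n,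
  supported on the exponents l to 3l. Hence the detour through the exact evaluation at a = q^n, a
  point that merges with a = 1 at the root of unity. Specialising q needs an object without
  denominators, so the sum is cleared over Q[q] before anything is evaluated at a root of
  unity.\<close>

lemma qpoch_0 [simp]: "qpoch a b 0 = 1"
  by (simp add: qpoch_def)

lemma qpoch_Suc: "qpoch a b (Suc k) = qpoch a b k * (1 - a * b ^ k)"
  by (simp add: qpoch_def)

lemma qpoch_Suc_shift: "qpoch a b (Suc k) = (1 - a) * qpoch (a * b) b k"
  by (simp add: qpoch_def prod.lessThan_Suc_shift mult.assoc del: prod.lessThan_Suc)

lemma qpoch_eq_0_iff:
  fixes a b :: "'a::idom"
  shows "qpoch a b k = 0 \<longleftrightarrow> (\<exists>i<k. a * b ^ i = 1)"
  by (auto simp: qpoch_def)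

text \<open>
  The summand with a parameter \<open>a\<close>: two of the three factors $(q;q^2)_k$ become
  $(aq;q^2)_k (q/a;q^2)_k$ and two of the three factors $(q^4;q^4)_k$ become
  $(aq^4;q^4)_k (q^4/a;q^4)_k$, so that \<open>a = 1\<close> gives back the original sum.
\<close>

definition qterm :: "'a::field \<Rightarrow> 'a \<Rightarrow> nat \<Rightarrow> 'a" where
  "qterm q a k =
     qpoch q (q ^ 4) k * qpoch q (q ^ 2) k * qpoch (a * q) (q ^ 2) k * qpoch (q / a) (q ^ 2) k
       * q ^ (k ^ 2 + k) /
     (qpoch (q ^ 2) (q ^ 2) k * qpoch (q ^ 4) (q ^ 4) k *
      qpoch (a * q ^ 4) (q ^ 4) k * qpoch (q ^ 4 / a) (q ^ 4) k)"

text \<open>The common factor \<open>1 / (1 - q)\<close> of the q-integers is left out here and in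
  \<open>qvalue\<close>; \<open>ratfun_cong_qsum\<close> restores it. The bound is exclusive, so the
  half sum has \<open>K = Suc ((n - 1) div 2)\<close>.\<close>

definition qsum :: "'a::field \<Rightarrow> 'a \<Rightarrow> nat \<Rightarrow> 'a" where
  "qsum q a K = (\<Sum>k<K. (1 - q ^ (6 * k + 1)) * qterm q a k)"

text \<open>
  The part common to \<open>qterm q a k\<close> and \<open>qterm q (a * q ^ 4) k\<close>. It starts from
  $(q^{-3}/a;q^2)_k$ rather than $(q/a;q^2)_k$, because dividing the latter by
  $(1 - q^{2k-3}/a)(1 - q^{2k-1}/a)$ would fail at \<open>a = q ^ n\<close>.
\<close>

definition qcert :: "'a::field \<Rightarrow> 'a \<Rightarrow> nat \<Rightarrow> 'a" where
  "qcert q a k =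
     qpoch q (q ^ 4) k * qpoch q (q ^ 2) k * qpoch (a * q) (q ^ 2) k *
       qpoch (1 / (a * q ^ 3)) (q ^ 2) k * q ^ (k ^ 2 + k) /
     (qpoch (q ^ 2) (q ^ 2) k * qpoch (q ^ 4) (q ^ 4) k *
      qpoch (a * q ^ 4) (q ^ 4) k * qpoch (q ^ 4 / a) (q ^ 4) k)"

text \<open>
  The Wilf--Zeilberger certificate for the shift \<open>a \<mapsto> a * q ^ 4\<close>, with \<open>y = q ^ (2 * k)\<close>.
\<close>

lemma certificate_identity:
  fixes q a y :: "'a::idom"
  shows "q * (1 - a * q^3) * (1 - q * y^3) * (1 - a * q * y) * (1 - a * q^3 * y) * (a - y^2)
     + (1 - a * q) * (1 - q * y^3) * (a * q^3 - y) * (a * q - y) * (1 - a * q^4 * y^2)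
     = ((1 - q * y^2) * (1 - q * y) * (1 - a * q * y) * (a * q^3 - y) * y
         - q * (1 - y) * (1 - y^2) * (a - y^2) * (1 - a * q^4 * y^2)) * (a^2 * q^4 - 1)"
  by algebra

lemma qpoch_Suc_Suc_shift:
  "qpoch a b k * (1 - a * b ^ k) * (1 - a * b ^ Suc k) =
      (1 - a) * (1 - a * b) * qpoch (a * b ^ 2) b k"
  using qpoch_Suc_shift[of a b "Suc k"] qpoch_Suc_shift[of "a * b" b k]
  by (simp add: qpoch_Suc power2_eq_square mult.assoc)

lemma qpoch_shift:
  "qpoch a b k * (1 - a * b ^ k) = (1 - a) * qpoch (a * b) b k"
  using qpoch_Suc_shift[of a b k] by (simp add: qpoch_Suc)

text \<open>The symbol (q/a;q^2)_k is the two-step shift of (q^{-3}/a;q^2)_k, the only factor in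
  which \<open>qterm q a k\<close> and \<open>qcert q a k\<close> differ. What remains are the four
  end factors, cleared of powers of q and a in \<open>f2\<close> to \<open>f5\<close>.\<close>

lemma qterm_qcert:
  fixes q a :: "'a::field"
  assumes "q \<noteq> 0" "a \<noteq> 0"
  shows "(1 - a * q) * (1 - a * q^3) * qterm q a k =
         (a * q^3 - q ^ (2 * k)) * (a * q - q ^ (2 * k)) * qcert q a k"
proof -
  have main: "qpoch (1 / (a * q^3)) (q^2) k * (1 - 1 / (a * q^3) * (q^2) ^ k) *
      (1 - 1 / (a * q^3) * (q^2) ^ Suc k)
     = (1 - 1 / (a * q^3)) * (1 - 1 / (a * q^3) * q^2) * qpoch (1 / (a * q^3) * (q^2)^2) (q^2) k"
    by (rule qpoch_Suc_Suc_shift)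
  have f1: "1 / (a * q^3) * (q^2)^2 = q / a"
    using assms by (simp add: field_simps flip: power_mult power_Suc)
  have f2: "1 - 1 / (a * q^3) * (q^2) ^ k = (a * q^3 - q ^ (2 * k)) / (a * q^3)"
    unfolding power_mult [symmetric] using assms by (simp add: field_simps)
  have f3: "1 - 1 / (a * q^3) * (q^2) ^ Suc k = (a * q - q ^ (2 * k)) / (a * q)"
    using assms by (simp add: field_simps power_mult power2_eq_square power3_eq_cube)
  have f4: "1 - 1 / (a * q^3) = - (1 - a * q^3) / (a * q^3)"
    using assms by (simp add: field_simps)
  have f5: "1 - 1 / (a * q^3) * q^2 = - (1 - a * q) / (a * q)"
    using assms by (simp add: field_simps power2_eq_square power3_eq_cube)
  note main = main[unfolded f1 f2 f3 f4 f5]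
  have "X * (Z / c) * (W / d) = (- A / c) * (- B / d) * Y \<Longrightarrow> c \<noteq> 0 \<Longrightarrow> d \<noteq> 0 \<Longrightarrow> B * A * Y = Z * W * X"
    for X Z W A B Y c d :: 'a by (simp add: field_simps)
  from this[OF main] have *: "(1 - a * q) * (1 - a * q^3) * qpoch (q / a) (q^2) k
     = (a * q^3 - q ^ (2 * k)) * (a * q - q ^ (2 * k)) * qpoch (1 / (a * q^3)) (q^2) k"
    using assms by simp
  have "(1 - a * q) * (1 - a * q^3) * qterm q a k =
     ((1 - a * q) * (1 - a * q^3) * qpoch (q / a) (q^2) k) *
     (qpoch q (q ^ 4) k * qpoch q (q ^ 2) k * qpoch (a * q) (q ^ 2) k * q ^ (k ^ 2 + k) /
     (qpoch (q ^ 2) (q ^ 2) k * qpoch (q ^ 4) (q ^ 4) k *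
      qpoch (a * q ^ 4) (q ^ 4) k * qpoch (q ^ 4 / a) (q ^ 4) k))"
    by (simp add: qterm_def)
  also have "\<dots> = (a * q^3 - q ^ (2 * k)) * (a * q - q ^ (2 * k)) * qcert q a k"
    unfolding * by (simp add: qcert_def)
  finally show ?thesis .
qed

text \<open>Replacing a by a q^4 turns q/a into q^{-3}/a, the argument built into
  \<open>qcert\<close>. The other symbols containing a move by two steps in base q^2 or one step in
  base q^4, so only end factors appear.\<close>

lemma qterm_shift_qcert:
  fixes q a :: "'a::field"
  assumes "q \<noteq> 0" "a \<noteq> 0"
    and "\<And>i. i \<le> Suc k \<Longrightarrow> a * q ^ (4 * i) \<noteq> 1" "\<And>i. i \<le> k \<Longrightarrow> a \<noteq> q ^ (4 * i)"
  shows "(1 - a * q) * (1 - a * q^3) * (1 - a) * (1 - a * q^4 * q ^ (4 * k)) * qterm q (a * q^4) k =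
         - (1 - a * q * q ^ (2 * k)) * (1 - a * q^3 * q ^ (2 * k)) * (1 - a * q^4) *
           (a - q ^ (4 * k)) * qcert q a k"
proof -
  have s1: "qpoch (a * q) (q^2) k * (1 - a * q * q ^ (2 * k)) * (1 - a * q^3 * q ^ (2 * k))
     = (1 - a * q) * (1 - a * q^3) * qpoch (a * q^4 * q) (q^2) k"
    using qpoch_Suc_Suc_shift[of "a * q" "q^2" k]
    by (simp add: power_mult power2_eq_square power3_eq_cube power4_eq_xxxx mult_ac
        power_mult_distrib)
  have s2: "q / (a * q^4) = 1 / (a * q^3)"
    using assms by (simp add: field_simps eval_nat_numeral)
  have s3: "qpoch (a * q^4) (q^4) k * (1 - a * q^4 * q ^ (4 * k)) =
      (1 - a * q^4) * qpoch (a * q^4 * q^4) (q^4) k"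
    using qpoch_shift[of "a * q^4" "q^4" k] by (simp add: power_mult)
  have s4: "qpoch (1 / a) (q^4) k * (1 - q ^ (4 * k) / a) = (1 - 1 / a) * qpoch (q^4 / a) (q^4) k"
    using qpoch_shift[of "1 / a" "q^4" k] by (simp add: power_mult)
  have s4': "qpoch (1 / a) (q^4) k * (a - q ^ (4 * k)) = - (1 - a) * qpoch (q^4 / a) (q^4) k"
    using s4 assms(2) by (simp add: field_simps)
  have e: "q^4 / (a * q^4) = 1 / a" using assms by simp
  define D where "D = qpoch (a * q^4) (q^4) k"
  define D' where "D' = qpoch (a * q^4 * q^4) (q^4) k"
  define E where "E = qpoch (q^4 / a) (q^4) k"
  define E' where "E' = qpoch (1 / a) (q^4) k"
  define U where "U = qpoch (a * q) (q^2) k"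
  define U' where "U' = qpoch (a * q^4 * q) (q^2) k"
  define R where "R = qpoch q (q ^ 4) k * qpoch q (q ^ 2) k * qpoch (1 / (a * q ^ 3)) (q ^ 2) k *
      q ^ (k ^ 2 + k) /
     (qpoch (q ^ 2) (q ^ 2) k * qpoch (q ^ 4) (q ^ 4) k)"
  have nz: "D \<noteq> 0" "D' \<noteq> 0" "E \<noteq> 0" "E' \<noteq> 0" "1 - a \<noteq> 0"
  proof -
    have *: "a * q^4 * (q^4)^i = a * q ^ (4 * Suc i)"
        "a * q^4 * q^4 * (q^4)^i = a * q ^ (4 * Suc (Suc i))" for i
      by (simp_all add: power_add[symmetric] power_mult[symmetric] mult.assoc)
    show "D \<noteq> 0" "D' \<noteq> 0"
      unfolding D_def D'_def qpoch_eq_0_iff *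
          using assms(3)[of "Suc _"] assms(3)[of "Suc (Suc _)"] by auto
    have **: "q^4 / a * (q^4)^i = q ^ (4 * Suc i) / a" "1 / a * (q^4)^i = q ^ (4 * i) / a" for i
      by (simp_all add: power_add[symmetric] power_mult[symmetric])
    have "q ^ (4 * i) / a \<noteq> 1" if "i \<le> k" for i
      using assms(2) assms(4)[OF that] by auto
    then show "E \<noteq> 0" "E' \<noteq> 0"
      unfolding E_def E'_def qpoch_eq_0_iff ** by (meson Suc_leI less_imp_le)+
    show "1 - a \<noteq> 0" using assms(3)[of 0] by simp
  qed
  have t: "qterm q (a * q^4) k = R * U' / (D' * E')"
    unfolding qterm_def R_def U'_def D'_def E'_def e s2 by (simp add: mult_ac)
  have c: "qcert q a k = R * U / (D * E)"
    unfolding qcert_def R_def U_def D_def E_def by (simp add: mult_ac)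
  note s = s1[folded U_def U'_def] s3[folded D_def D'_def] s4'[folded E_def E'_def]
  define y where "y = q ^ (2 * k)"
  define w where "w = q ^ (4 * k)"
  note s = s[folded y_def w_def]
  have "((1 - a * q) * (1 - a * q^3) * U') * ((1 - a) * E) * (D * (1 - a * q^4 * w)) * R =
         (U * (1 - a * q * y) * (1 - a * q^3 * y)) * (- (E' * (a - w))) * ((1 - a * q^4) * D') * R"
    unfolding s by algebra
  moreover have "p1 * p2 * U' * (n * E) * (D * v) * R = U * r * s * (- (E' * g)) * (h * D') * R \<Longrightarrow>
      p1 * p2 * n * v * (R * U' / (D' * E')) = - r * s * h * g * (R * U / (D * E))"
    for p1 p2 n v r s g h :: 'a
    using nz(1-4) by (simp add: divide_simps mult_ac)
  ultimately show ?thesis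
    unfolding t c y_def[symmetric] w_def[symmetric] by blast
qed

text \<open>The Wilf-Zeilberger companion. The factors in q^{2k} and q^{4k} make it 0 at k = 0 and
  cancel three of the four factors by which the denominator of \<open>qcert\<close> grows from k - 1
  to k.\<close>

definition qtele :: "'a::field \<Rightarrow> 'a \<Rightarrow> nat \<Rightarrow> 'a" where
  "qtele q a k = (1 - q ^ (2 * k)) * (1 - q ^ (4 * k)) * (a - q ^ (4 * k)) *
      (a ^ 2 * q ^ 4 - 1) * qcert q a k"

text \<open>The fourth new denominator factor, 1 - a q^{4k+4}, is moved to the left. The lone q
  there is the q^3 of 1/(a q^3) against the q^2 in the growth q^{2k+2} of q^{k^2+k}.\<close>

lemma qcert_Suc:
  fixes q a :: "'a::field"
  assumes "q \<noteq> 0" "a \<noteq> 0"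
    and "\<And>i. i \<le> k \<Longrightarrow> q ^ (2 * Suc i) \<noteq> 1" "\<And>i. i \<le> k \<Longrightarrow> q ^ (4 * Suc i) \<noteq> 1"
    and "\<And>i. i \<le> Suc k \<Longrightarrow> a * q ^ (4 * i) \<noteq> 1" "\<And>i. i \<le> Suc k \<Longrightarrow> a \<noteq> q ^ (4 * i)"
  shows "q * (1 - a * q^4 * q ^ (4 * k)) *
      ((1 - q ^ (2 * Suc k)) * (1 - q ^ (4 * Suc k)) * (a - q ^ (4 * Suc k)) * qcert q a (Suc k))
    = (1 - q * q ^ (4 * k)) * (1 - q * q ^ (2 * k)) * (1 - a * q * q ^ (2 * k)) *
        (a * q^3 - q ^ (2 * k)) * q ^ (2 * k) * qcert q a k"
proof -
  define y where "y = q ^ (2 * k)"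
  define w where "w = q ^ (4 * k)"
  have p: "(q^2)^k = y" "(q^4)^k = w" by (simp_all add: y_def w_def power_mult power_mult_distrib)
  have p': "q ^ (2 * Suc k) = q^2 * y" "q ^ (4 * Suc k) = q^4 * w" 
    by (simp_all only: y_def w_def mult_Suc_right power_add)
  have r: "q ^ ((Suc k)^2 + Suc k) = q ^ (k^2 + k) * q^2 * y"
    by (simp add: y_def power2_eq_square power_add power_mult_distrib mult_2)
  have nz: "1 - q^2 * y \<noteq> 0" "1 - q^4 * w \<noteq> 0" "1 - a * q^4 * w \<noteq> 0" "a - q^4 * w \<noteq> 0"
    using assms(3)[of k] assms(4)[of k] assms(5)[of "Suc k"] assms(6)[of "Suc k"] unfolding p'
        by (auto simp: mult.assoc)
  have rel: "qcert q a (Suc k) = qcert q a k *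
     ((1 - q * w) * (1 - q * y) * (1 - a * q * y) * (1 - 1 / (a * q^3) * y) * (q^2 * y) /
      ((1 - q^2 * y) * (1 - q^4 * w) * (1 - a * q^4 * w) * (1 - q^4 / a * w)))"
    unfolding qcert_def qpoch_Suc p r by (simp add: mult_ac)
  have f1: "1 - q^4 / a * w = (a - q^4 * w) / a" using assms by (simp add: field_simps)
  have f2: "1 - 1 / (a * q^3) * y = (a * q^3 - y) / (a * q^3)" using assms
      by (simp add: field_simps)
  have f3: "q^3 = q^2 * q" by (simp add: eval_nat_numeral)
  define Z where "Z = a * q^3 - y"
  show ?thesis
    unfolding rel p' f1 f2 y_def[symmetric] w_def[symmetric] Z_def[symmetric]
    unfolding f3 using nz assms(1,2) by (simp add: divide_simps)
qed

text \<open>Both terms are rational multiples of \<open>qcert q a k\<close>; after multiplication by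
  the nonzero \<open>V\<close> the claim becomes \<open>certificate_identity\<close> at y =
  q^{2k}.\<close>

lemma qtele_diff:
  fixes q a :: "'a::field"
  assumes q: "q \<noteq> 0" and a: "a \<noteq> 0"
    and q2: "\<And>i. i \<le> k \<Longrightarrow> q ^ (2 * Suc i) \<noteq> 1" and q4: "\<And>i. i \<le> k \<Longrightarrow> q ^ (4 * Suc i) \<noteq> 1"
    and a1: "\<And>i. i \<le> Suc k \<Longrightarrow> a * q ^ (4 * i) \<noteq> 1" and a2: "\<And>i. i \<le> Suc k \<Longrightarrow> a \<noteq> q ^ (4 * i)"
  shows "(1 - q ^ (6 * k + 1)) * (1 - a * q) * (1 - a * q^3) *
      ((1 - a * q) * (1 - a * q^4) * qterm q a k - q * (1 - a * q^3) * (1 - a) *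
          qterm q (a * q^4) k)
    = q * (1 - a * q^4) * (qtele q a (Suc k) - qtele q a k)"
proof -
  define y where "y = q ^ (2 * k)"
  define w where "w = q ^ (4 * k)"
  define C where "C = qcert q a k"
  define V where "V = 1 - a * q^4 * w"
  have p: "w = y^2" "q ^ (6 * k + 1) = q * y^3"
    by (simp_all add: y_def w_def power_mult[symmetric] power_add)
  have V: "V \<noteq> 0"
    using a1[of "Suc k"] by (simp add: V_def w_def power_add mult_ac)
  have A: "(1 - a * q) * (1 - a * q^3) * qterm q a k = (a * q^3 - y) * (a * q - y) * C"
    unfolding y_def C_def by (rule qterm_qcert[OF q a])
  have B: "(1 - a * q) * (1 - a * q^3) * (1 - a) * V * qterm q (a * q^4) k =
         - (1 - a * q * y) * (1 - a * q^3 * y) * (1 - a * q^4) * (a - w) * C"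
    unfolding y_def w_def C_def V_def by (rule qterm_shift_qcert[OF q a]) (use a1 a2 in auto)
  have D: "q * V * qtele q a (Suc k) = (1 - q * w) * (1 - q * y) * (1 - a * q * y) *
      (a * q^3 - y) * y * C * (a^2 * q^4 - 1)"
    using qcert_Suc[OF q a q2 q4 a1 a2, of k]
    unfolding y_def[symmetric] w_def[symmetric] C_def[symmetric] V_def[symmetric] qtele_def
    by (simp add: mult_ac)
  have E: "qtele q a k = (1 - y) * (1 - w) * (a - w) * (a^2 * q^4 - 1) * C"
    by (simp add: qtele_def y_def w_def C_def)
  have "V * ((1 - q * y^3) * (1 - a * q) * (1 - a * q^3) *
      ((1 - a * q) * (1 - a * q^4) * qterm q a k - q * (1 - a * q^3) * (1 - a) *
          qterm q (a * q^4) k))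
    = (1 - q * y^3) * ((1 - a * q) * (1 - a * q^4) * V * ((1 - a * q) * (1 - a * q^3) * qterm q a k)
       - q * (1 - a * q^3) * ((1 - a * q) * (1 - a * q^3) * (1 - a) * V * qterm q (a * q^4) k))"
    by algebra
  also have "\<dots> = (1 - a * q^4) * C * (q * (1 - a * q^3) * (1 - q * y^3) * (1 - a * q * y) *
      (1 - a * q^3 * y) * (a - w)
     + (1 - a * q) * (1 - q * y^3) * (a * q^3 - y) * (a * q - y) * V)"
    unfolding A B by algebra
  also have "\<dots> = (1 - a * q^4) * C * (((1 - q * w) * (1 - q * y) * (1 - a * q * y) *
      (a * q^3 - y) * y
         - q * (1 - y) * (1 - w) * (a - w) * V) * (a^2 * q^4 - 1))"
    using certificate_identity[of q a y] unfolding V_def p by metis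
  also have "\<dots> = (1 - a * q^4) * (q * V * qtele q a (Suc k) - q * V * qtele q a k)"
    unfolding D unfolding E by algebra
  also have "\<dots> = V * (q * (1 - a * q^4) * (qtele q a (Suc k) - qtele q a k))"
    by algebra
  finally show ?thesis
    unfolding p mult_left_cancel[OF V] .
qed

text \<open>It is applied in two situations, q generic with a = q^n and q a primitive root of unity
  with a generic. In each the upper boundary term \<open>qtele q a K\<close> vanishes, for different
  reasons.\<close>

lemma qsum_shift:
  fixes q a :: "'a::field"
  assumes q: "q \<noteq> 0" and a: "a \<noteq> 0"
    and q2: "\<And>i. i < K \<Longrightarrow> q ^ (2 * Suc i) \<noteq> 1" and q4: "\<And>i. i < K \<Longrightarrow> q ^ (4 * Suc i) \<noteq> 1"
    and a1: "\<And>i. i \<le> K \<Longrightarrow> a * q ^ (4 * i) \<noteq> 1" and a2: "\<And>i. i \<le> K \<Longrightarrow> a \<noteq> q ^ (4 * i)"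
  shows "(1 - a * q) * (1 - a * q^3) *
      ((1 - a * q) * (1 - a * q^4) * qsum q a K - q * (1 - a * q^3) * (1 - a) * qsum q (a * q^4) K)
    = q * (1 - a * q^4) * qtele q a K"
proof -
  have "(1 - a * q) * (1 - a * q^3) *
      ((1 - a * q) * (1 - a * q^4) * qsum q a K - q * (1 - a * q^3) * (1 - a) * qsum q (a * q^4) K)
    = (\<Sum>k<K. (1 - q ^ (6 * k + 1)) * (1 - a * q) * (1 - a * q^3) *
      ((1 - a * q) * (1 - a * q^4) * qterm q a k - q * (1 - a * q^3) * (1 - a) *
          qterm q (a * q^4) k))"
    unfolding qsum_def sum_distrib_left sum_subtractf[symmetric]
    by (intro sum.cong refl) algebra
  also have "\<dots> = (\<Sum>k<K. q * (1 - a * q^4) * (qtele q a (Suc k) - qtele q a k))"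
    by (intro sum.cong refl qtele_diff q a q2 q4 a1 a2) auto
  also have "\<dots> = q * (1 - a * q^4) * (qtele q a K - qtele q a 0)"
    by (simp only: sum_distrib_left[symmetric] sum_lessThan_telescope)
  also have "qtele q a 0 = 0" by (simp add: qtele_def)
  finally show ?thesis by simp
qed

section \<open>The terminating sum\<close>

lemma power_inj_if_not_root_of_unity:
  fixes q :: "'a::field"
  assumes "q \<noteq> 0" "\<And>m. m > 0 \<Longrightarrow> q ^ m \<noteq> 1"
  shows "q ^ i = q ^ j \<longleftrightarrow> i = j"
proof -
  have *: "q ^ i \<noteq> q ^ j" if "i < j" for i j
  proof
    assume "q ^ i = q ^ j"
    also have "\<dots> = q ^ i * q ^ (j - i)"
      using that by (simp flip: power_add)
    finally have "q ^ (j - i) = 1" using assms(1) by simp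
    then show False using assms(2)[of "j - i"] that by simp
  qed
  show ?thesis using *[of i j] *[of j i] by (metis linorder_neqE_nat)
qed

lemma qterm_eq_0:
  fixes q :: "'a::field"
  assumes "q \<noteq> 0" "odd n" "(n - 1) div 2 < k"
  shows "qterm q (q ^ n) k = 0"
proof -
  have "q / q ^ n * (q^2) ^ ((n - 1) div 2) = 1"
    using assms by (auto elim!: oddE simp: power_mult[symmetric])
  then have "qpoch (q / q ^ n) (q^2) k = 0"
    unfolding qpoch_eq_0_iff using assms(3) by blast
  then show ?thesis by (simp add: qterm_def)
qed

lemma qsum_cutoff:
  fixes q :: "'a::field"
  assumes "q \<noteq> 0" "odd n" "(n - 1) div 2 < K"
  shows "qsum q (q ^ n) K = qsum q (q ^ n) (Suc ((n - 1) div 2))"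
  unfolding qsum_def
  by (rule sum.mono_neutral_right) (use assms in \<open>auto simp: qterm_eq_0\<close>)

text \<open>The recurrence compares sums of equal length; n + 5 lies beyond the last nonzero term of
  both, (n - 1)/2 and (n + 3)/2.\<close>

lemma qsum_power_step:
  fixes q :: "'a::field"
  assumes q: "q \<noteq> 0" and nr: "\<And>m. m > 0 \<Longrightarrow> q ^ m \<noteq> 1" and n: "odd n"
  shows "q * (1 - q ^ (n + 3)) * (1 - q ^ n) * qsum q (q ^ (n + 4)) (n + 5) =
         (1 - q ^ (n + 1)) * (1 - q ^ (n + 4)) * qsum q (q ^ n) (n + 5)"
proof -
  have inj: "q ^ i = q ^ j \<longleftrightarrow> i = j" for i j
    by (rule power_inj_if_not_root_of_unity[OF q nr])
  have z: "qtele q (q ^ n) (n + 5) = 0"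
  proof -
    from n obtain m where m: "n = 2 * m + 1" by (auto elim: oddE)
    \<comment> \<open>The factor of (q^{-n-3};q^2)_{n+5} with index m + 2 = (n + 3)/2 is 0, which
      kills the boundary term.\<close>
    have "1 / (q ^ n * q^3) * (q^2) ^ (m + 2) = 1"
      using q by (simp add: m power_mult[symmetric] power_add power2_eq_square power3_eq_cube
          power_mult_distrib mult_2)
    then have "qpoch (1 / (q ^ n * q^3)) (q^2) (n + 5) = 0"
      unfolding qpoch_eq_0_iff by (intro exI[of _ "m + 2"]) (simp add: m)
    then show ?thesis by (simp add: qtele_def qcert_def)
  qed
  have "(1 - q ^ n * q) * (1 - q ^ n * q^3) *
      ((1 - q ^ n * q) * (1 - q ^ n * q^4) * qsum q (q ^ n) (n + 5)
        - q * (1 - q ^ n * q^3) * (1 - q ^ n) * qsum q (q ^ n * q^4) (n + 5)) = 0"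
  proof (subst qsum_shift)
    show "q ^ n \<noteq> q ^ (4 * i)" for i unfolding inj using n by auto
    show "q ^ n * q ^ (4 * i) \<noteq> 1" for i
      unfolding power_add[symmetric] using n by (intro nr) (auto elim: oddE)
    show "q ^ (2 * Suc i) \<noteq> 1" "q ^ (4 * Suc i) \<noteq> 1" for i
      by (rule nr, simp)+
  qed (use q z in auto)
  moreover have "1 - q ^ n * q \<noteq> 0" "1 - q ^ n * q^3 \<noteq> 0"
    using nr[of "n + 1"] nr[of "n + 3"] by (simp_all add: power_add mult.commute)
  ultimately show ?thesis by (simp add: power_add mult_ac)
qed

definition qvalue :: "'a::field \<Rightarrow> nat \<Rightarrow> 'a" where
  "qvalue q n = (if n mod 4 = 1
     then qpoch (q ^ 2) (q ^ 4) ((n - 1) div 4) / qpoch (q ^ 4) (q ^ 4) ((n - 1) div 4) *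
          (1 - q ^ n) / q ^ ((n - 1) div 4)
     else 0)"

lemma qsum_power:
  fixes q :: "'a::field"
  assumes q: "q \<noteq> 0" and nr: "\<And>m. m > 0 \<Longrightarrow> q ^ m \<noteq> 1" and n: "odd n"
  shows "qsum q (q ^ n) (Suc ((n - 1) div 2)) = qvalue q n"
  using n
proof (induction n rule: less_induct)
  case (less n)
  have nz: "1 - q ^ m \<noteq> 0" if "m > 0" for m using nr[OF that] by simp
  have "n = 1 \<or> n = 3 \<or> n \<ge> 5"
    using less.prems by presburger
  then consider "n = 1" | "n = 3" | "n \<ge> 5" by blast
  then show ?case
  proof cases
    case 1
    then show ?thesis by (simp add: qsum_def qterm_def qvalue_def)
  next
    case 2
    \<comment> \<open>For n = 3 only k = 0 and k = 1 occur, and they contribute 1 - q and its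
      negative.\<close>
    have t: "qterm q (q^3) 1 =
      ((1 - q) * (1 - q) * (1 - q^4) * (1 - q / q^3) * q^2) /
          ((1 - q^2) * (1 - q^4) * (1 - q^7) * (1 - q^4 / q^3))"
      by (simp add: qterm_def qpoch_Suc flip: power_add power_Suc2) (simp add: power2_eq_square)
    have e1: "1 - q / q^3 = - (1 - q^2) / q^2" "q^4 / q^3 = q"
      using q by (simp_all add: field_simps eval_nat_numeral)
    have "qterm q (q^3) 1 = - (1 - q) / (1 - q^7)"
      unfolding t e1 using nz[of 2] nz[of 4] nz[of 7] nz[of 1] q
          by (simp add: divide_simps) (simp add: algebra_simps)
    then have "qterm q (q^3) (Suc 0) * (1 - q^7) = - (1 - q)"
      using nz[of 7] by simp
    moreover have "q * q^6 = q^7" by (simp add: eval_nat_numeral)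
    ultimately show ?thesis
      using 2 by (simp add: qsum_def qvalue_def numeral_2_eq_2 qterm_def[of _ _ 0] mult.commute)
  next
    case 3
    define m where "m = n - 4"
    have n: "n = m + 4" "odd m" "m < n" "m > 0" using 3 less.prems by (auto simp: m_def)
    have IH: "qsum q (q ^ m) (m + 5) = qvalue q m"
      using less.IH[OF n(3,2)] qsum_cutoff[OF q n(2), of "m + 5"] by simp
    have S: "qsum q (q ^ n) (m + 5) = qsum q (q ^ n) (Suc ((n - 1) div 2))"
      by (rule qsum_cutoff[OF q]) (use n in auto)
    have st: "q * (1 - q ^ (m + 3)) * (1 - q ^ m) * qsum q (q ^ n) (m + 5) =
         (1 - q ^ (m + 1)) * (1 - q ^ (m + 4)) * qvalue q m"
      using qsum_power_step[OF q nr n(2)] unfolding IH n(1) by simp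
    \<comment> \<open>The closed form obeys the same recurrence: from m to m + 4 each Pochhammer
      symbol gains one factor and the denominator one q. In the other residue class both values are
      0.\<close>
    have st2: "q * (1 - q ^ (m + 3)) * (1 - q ^ m) * qvalue q n =
        (1 - q ^ (m + 1)) * (1 - q ^ (m + 4)) * qvalue q m"
    proof (cases "m mod 4 = 1")
      case False
      then have "n mod 4 \<noteq> 1" using n(1) by simp
      with False show ?thesis by (simp add: qvalue_def)
    next
      case True
      define l where "l = m div 4"
      have ml: "m = 4 * l + 1" using True by (simp add: l_def) presburger
      have nl: "n = 4 * Suc l + 1" using ml n by simp
      have v: "qvalue q m = qpoch (q^2) (q^4) l / qpoch (q^4) (q^4) l * (1 - q ^ m) / q ^ l"
              "qvalue q n = qpoch (q^2) (q^4) (Suc l) / qpoch (q^4) (q^4) (Suc l) * (1 - q ^ n) /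
                  q ^ Suc l"
        by (simp_all add: qvalue_def ml nl del: power_Suc mult_Suc_right)
      have e: "q^2 * (q^4)^l = q ^ (m + 1)" "q^4 * (q^4)^l = q ^ (m + 3)"
        by (simp_all add: ml power_mult[symmetric] power_add[symmetric] add.commute)
      have p0: "qpoch (q^4) (q^4) l \<noteq> 0"
        using nr by (auto simp: qpoch_eq_0_iff power_mult[symmetric] power_add[symmetric])
      show ?thesis
        unfolding v qpoch_Suc e n(1)[symmetric] power_Suc
        using p0 q nz[of "m + 3"] by simp
    qed
    have "q * (1 - q ^ (m + 3)) * (1 - q ^ m) \<noteq> 0"
      using q nz[of "m + 3"] nz[of m] n by simp
    then show ?thesis
      using st unfolding st2[symmetric] S by (metis mult_left_cancel)
  qed
qed

section \<open>Clearing denominators\<close>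

lemma qpoch_split: "k \<le> M \<Longrightarrow> qpoch a b M = qpoch a b k * (\<Prod>i = k..<M. 1 - a * b ^ i)"
  unfolding qpoch_def lessThan_atLeast0 by (simp add: prod.atLeastLessThan_concat)

text \<open>The part of the summand free of a, times (q^2;q^2)_M (q^4;q^4)_M; the last product is
  what these leave after cancelling the denominators of index k.\<close>

definition cleared_coeff :: "'a::comm_ring_1 \<Rightarrow> nat \<Rightarrow> nat \<Rightarrow> 'a" where
  "cleared_coeff q M k = (1 - q ^ (6 * k + 1)) * qpoch q (q ^ 4) k * qpoch q (q ^ 2) k *
      q ^ (k ^ 2 + k) *
     (\<Prod>i = k..<M. (1 - q ^ (2 * Suc i)) * (1 - q ^ (4 * Suc i)))"

text \<open>Here \<open>f c\<close> stands for the pair (1 - ac)(1 - c/a). Keeping \<open>f\<close>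
  abstract yields the same cleared sum as a polynomial in x (\<open>sym_factor\<close>) and, up to a
  power of a, as a polynomial in a (\<open>recip_factor\<close>).\<close>

definition odd_factors :: "('a \<Rightarrow> 'a poly) \<Rightarrow> 'a::comm_ring_1 \<Rightarrow> nat \<Rightarrow> 'a poly" where
  "odd_factors f q k = (\<Prod>i<k. f (q ^ (2 * i + 1)))"

definition quad_factors :: "('a \<Rightarrow> 'a poly) \<Rightarrow> 'a::comm_ring_1 \<Rightarrow> nat \<Rightarrow> nat \<Rightarrow> 'a poly" where
  "quad_factors f q M k = (\<Prod>i = k..<M. f (q ^ (4 * Suc i)))"

definition cleared_sum :: "('a \<Rightarrow> 'a poly) \<Rightarrow> 'a::comm_ring_1 \<Rightarrow> nat \<Rightarrow> 'a poly" where
  "cleared_sum f q M =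
     (\<Sum>k\<le>M. smult (cleared_coeff q M k) (odd_factors f q k * quad_factors f q M k))"

text \<open>
  With $x = (1-a)^2/a$ one has $(1-ac)(1-c/a) = (1-c)^2 - cx$. In this variable \<open>a = 1\<close> is
  \<open>x = 0\<close>, and \<open>a = q ^ n\<close> is a point \<open>x\<close> divisible by $(1-q^n)^2$.
\<close>

definition sym_factor :: "'a::comm_ring_1 \<Rightarrow> 'a poly" where
  "sym_factor c = [:(1 - c) ^ 2, - c:]"

abbreviation cleared_poly :: "'a::comm_ring_1 \<Rightarrow> nat \<Rightarrow> 'a poly" where
  "cleared_poly \<equiv> cleared_sum sym_factor"

lemma poly_symmetric_factor:
  fixes a c :: "'a::field"
  assumes "a \<noteq> 0"
  shows "poly (sym_factor c) ((1 - a) ^ 2 / a) = (1 - a * c) * (1 - c / a)"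
  using assms by (simp add: sym_factor_def field_simps power2_eq_square)

text \<open>The tail products in \<open>cleared_coeff\<close> and \<open>quad_factors\<close>
  complete every denominator from length k to length M, so a single factor serves all
  summands.\<close>

lemma poly_cleared_poly:
  fixes q a :: "'a::field"
  assumes a: "a \<noteq> 0"
    and q2: "\<And>i. i < M \<Longrightarrow> q ^ (2 * Suc i) \<noteq> 1" and q4: "\<And>i. i < M \<Longrightarrow> q ^ (4 * Suc i) \<noteq> 1"
    and a1: "\<And>i. i < M \<Longrightarrow> a * q ^ (4 * Suc i) \<noteq> 1" and a2: "\<And>i. i < M \<Longrightarrow> a \<noteq> q ^ (4 * Suc i)"
  shows "poly (cleared_poly q M) ((1 - a) ^ 2 / a) =
     qpoch (q^2) (q^2) M * qpoch (q^4) (q^4) M *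
         (qpoch (a * q^4) (q^4) M * qpoch (q^4 / a) (q^4) M) *
     qsum q a (Suc M)"
proof -
  have pw: "a * q^4 * (q^4)^i = a * q ^ (4 * Suc i)" "q^4 / a * (q^4)^i = q ^ (4 * Suc i) / a"
     "q^4 * (q^4)^i = q ^ (4 * Suc i)" "q^2 * (q^2)^i = q ^ (2 * Suc i)"
     "a * q * (q^2)^i = a * q ^ (2 * i + 1)" "q / a * (q^2)^i = q ^ (2 * i + 1) / a" for i
    by (simp_all add: power_mult[symmetric] power_add mult_ac) (simp add: power2_eq_square)
  have "poly (smult (cleared_coeff q M k) (odd_factors sym_factor q k *
      quad_factors sym_factor q M k)) ((1 - a) ^ 2 / a)
    = qpoch (q^2) (q^2) M * qpoch (q^4) (q^4) M *
        (qpoch (a * q^4) (q^4) M * qpoch (q^4 / a) (q^4) M) *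
      ((1 - q ^ (6 * k + 1)) * qterm q a k)" if k: "k \<le> M" for k
  proof -
    define E1 where "E1 = (\<Prod>i = k..<M. 1 - q ^ (2 * Suc i))"
    define E2 where "E2 = (\<Prod>i = k..<M. 1 - q ^ (4 * Suc i))"
    define E3 where "E3 = (\<Prod>i = k..<M. 1 - a * q ^ (4 * Suc i))"
    define E4 where "E4 = (\<Prod>i = k..<M. 1 - q ^ (4 * Suc i) / a)"
    have s: "qpoch (q^2) (q^2) M = qpoch (q^2) (q^2) k * E1"
      "qpoch (q^4) (q^4) M = qpoch (q^4) (q^4) k * E2"
      "qpoch (a * q^4) (q^4) M = qpoch (a * q^4) (q^4) k * E3"
      "qpoch (q^4 / a) (q^4) M = qpoch (q^4 / a) (q^4) k * E4"
      unfolding E1_def E2_def E3_def E4_def qpoch_split[OF k] pw by simp_all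
    have nz: "qpoch (q^2) (q^2) k \<noteq> 0" "qpoch (q^4) (q^4) k \<noteq> 0"
       "qpoch (a * q^4) (q^4) k \<noteq> 0" "qpoch (q^4 / a) (q^4) k \<noteq> 0"
    proof -
      show "qpoch (q^2) (q^2) k \<noteq> 0" unfolding qpoch_eq_0_iff pw using q2 k
          by (meson order_less_le_trans)
      show "qpoch (q^4) (q^4) k \<noteq> 0" unfolding qpoch_eq_0_iff pw using q4 k
          by (meson order_less_le_trans)
      show "qpoch (a * q^4) (q^4) k \<noteq> 0" unfolding qpoch_eq_0_iff pw using a1 k
          by (meson order_less_le_trans)
      show "qpoch (q^4 / a) (q^4) k \<noteq> 0" 
      proof
        assume "qpoch (q^4 / a) (q^4) k = 0"
        then obtain i where i: "i < k" "q ^ (4 * Suc i) / a = 1" unfolding qpoch_eq_0_iff pw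
            by blast
        then have "a = q ^ (4 * Suc i)" using a by simp
        then show False using a2[of i] i k by simp
      qed
    qed
    define B where "B = qpoch q (q ^ 4) k * qpoch q (q ^ 2) k * q ^ (k ^ 2 + k)"
    define c where "c = 1 - q ^ (6 * k + 1)"
    have "poly (smult (cleared_coeff q M k) (odd_factors sym_factor q k *
        quad_factors sym_factor q M k)) ((1 - a) ^ 2 / a)
     = cleared_coeff q M k * ((\<Prod>i<k. (1 - a * q ^ (2 * i + 1)) * (1 - q ^ (2 * i + 1) / a)) *
         (E3 * E4))"
      unfolding poly_smult poly_mult odd_factors_def quad_factors_def poly_prod
          poly_symmetric_factor[OF a] E3_def E4_def prod.distrib by simp
    also have "(\<Prod>i<k. (1 - a * q ^ (2 * i + 1)) * (1 - q ^ (2 * i + 1) / a)) =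
        qpoch (a * q) (q^2) k * qpoch (q / a) (q^2) k"
      unfolding qpoch_def prod.distrib pw ..
    also have "cleared_coeff q M k * (qpoch (a * q) (q^2) k * qpoch (q / a) (q^2) k * (E3 * E4)) =
        c * B * (E1 * E2) * (qpoch (a * q) (q^2) k * qpoch (q / a) (q^2) k * (E3 * E4))"
      by (simp add: cleared_coeff_def E1_def E2_def prod.distrib B_def c_def)
    finally have L: "poly (smult (cleared_coeff q M k) (odd_factors sym_factor q k *
        quad_factors sym_factor q M k)) ((1 - a) ^ 2 / a)
     = c * B * (E1 * E2) * (qpoch (a * q) (q^2) k * qpoch (q / a) (q^2) k * (E3 * E4))" .
    have R: "qterm q a k = B * (qpoch (a * q) (q^2) k * qpoch (q / a) (q^2) k) /
      (qpoch (q^2) (q^2) k * qpoch (q^4) (q^4) k * qpoch (a * q^4) (q^4) k *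
          qpoch (q^4 / a) (q^4) k)"
      by (simp add: qterm_def B_def mult_ac)
    show ?thesis
      unfolding L R s c_def[symmetric] using nz by simp
  qed
  then show ?thesis
    unfolding cleared_sum_def poly_sum qsum_def sum_distrib_left lessThan_Suc_atMost
    by (intro sum.cong refl) auto
qed

section \<open>Powers of a primitive root of unity\<close>

lemma primitive_roots_power_eq_1:
  assumes "z \<in> primitive_roots n" "n > 0"
  shows "z ^ m = 1 \<longleftrightarrow> n dvd m"
proof
  assume "z ^ m = 1"
  have "z ^ n = 1" using assms by (simp add: primitive_roots_def)
  have "z ^ m = z ^ (n * (m div n) + m mod n)" by simp
  also have "\<dots> = z ^ (m mod n)"
    by (simp only: power_add power_mult \<open>z ^ n = 1\<close> power_one mult_1)
  finally have "z ^ (m mod n) = 1" using \<open>z ^ m = 1\<close> by simp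
  moreover have "m mod n < n" using assms by simp
  ultimately have "m mod n = 0" using assms by (auto simp: primitive_roots_def)
  then show "n dvd m" by auto
next
  assume "n dvd m"
  then show "z ^ m = 1" using assms by (auto simp: primitive_roots_def power_mult elim!: dvdE)
qed

lemma primitive_roots_nonzero: "z \<in> primitive_roots n \<Longrightarrow> n > 0 \<Longrightarrow> z \<noteq> 0"
  by (auto simp: primitive_roots_def power_0_left)

section \<open>Vanishing at primitive roots of unity\<close>

text \<open>
  For $n \equiv 1 \pmod 4$ the equation propagates the root \<open>1\<close> in both directions to all
  \<open>n\<close>-th roots of unity; for $n \equiv 3 \pmod 4$ the resulting recurrence for the coefficients,
  run upwards from \<open>0\<close> and downwards from \<open>n\<close>, annihilates all of them.
\<close>

lemma functional_equation_imp_0: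
  fixes P :: "complex poly" and q :: complex
  assumes prim: "q \<in> primitive_roots n" and n: "odd n" "n \<ge> 3"
    and deg: "degree P < n"
    and eq: "[:q, - (q ^ 4):] * pcompose P [:0, q ^ 4:] = [:1, - q:] * P"
    and P1: "n mod 4 = 1 \<Longrightarrow> poly P 1 = 0"
  shows "P = 0"
proof -
  have npos: "n > 0" using n by simp
  note ord = primitive_roots_power_eq_1[OF prim npos]
  have q: "q \<noteq> 0" using primitive_roots_nonzero[OF prim npos] .
  show ?thesis
  proof (cases "n mod 4 = 1")
    case True
    define l where "l = n div 4"
    have nl: "n = 4 * l + 1" using True by (simp add: l_def) presburger
    have step: "q * (1 - q ^ (4 * i + 3)) * poly P (q ^ (4 * Suc i)) =
        (1 - q ^ (4 * i + 1)) * poly P (q ^ (4 * i))" for i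
    proof -
      have "poly ([:q, - (q ^ 4):] * pcompose P [:0, q ^ 4:]) (q ^ (4 * i)) =
          poly ([:1, - q:] * P) (q ^ (4 * i))"
        unfolding eq ..
      then have "(q - q ^ (4 * i) * q ^ 4) * poly P (q ^ (4 * i) * q ^ 4) =
          (1 - q ^ (4 * i) * q) * poly P (q ^ (4 * i))"
        by (simp add: poly_pcompose left_diff_distrib mult.assoc)
      moreover have "q ^ (4 * i) * q ^ 4 = q ^ (4 * Suc i)" by (simp add: power_add)
      moreover have "q - q ^ (4 * Suc i) = q * (1 - q ^ (4 * i + 3))"
        by (simp add: power_add algebra_simps eval_nat_numeral)
      ultimately show ?thesis by (simp add: mult.commute)
    qed
    \<comment> \<open>Upwards, 1 - q^{4i+3} first vanishes at i = 3l, where 4i + 3 = 3n. Downwards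
      from n, 1 - q^{4i+1} first vanishes at i = l, where 4i + 1 = n. So the runs reach 0..3l and
      l+1..n, which together cover everything.\<close>
    have up: "i \<le> 3 * l \<Longrightarrow> poly P (q ^ (4 * i)) = 0" for i
    proof (induction i)
      case 0
      then show ?case using P1[OF True] by simp
    next
      case (Suc i)
      have "\<not> n dvd 4 * i + 3"
      proof
        assume "n dvd 4 * i + 3"
        then obtain c where c: "4 * i + 3 = n * c" by (elim dvdE)
        have "4 * i + 3 < n * 3" using Suc.prems nl by simp
        then have "c < 3" using c npos by (metis mult_less_cancel1)
        then have "c = 0 \<or> c = 1 \<or> c = 2" by auto
        then show False using c nl by (elim disjE) (simp; presburger)+
      qed
      then have "1 - q ^ (4 * i + 3) \<noteq> 0" using ord[of "4 * i + 3"] by simp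
      then show ?case using step[of i] Suc q by simp
    qed
    have down: "i \<le> 3 * l \<Longrightarrow> poly P (q ^ (4 * (n - i))) = 0" for i
    proof (induction i)
      case 0
      have "q ^ (4 * n) = 1" using ord by simp
      then show ?case using P1[OF True] by simp
    next
      case (Suc i)
      define j where "j = n - Suc i"
      have j: "n - i = Suc j" "j > l" "j < n" using Suc.prems nl by (auto simp: j_def)
      have "\<not> n dvd 4 * j + 1"
      proof
        assume "n dvd 4 * j + 1"
        then obtain c where c: "4 * j + 1 = n * c" by (elim dvdE)
        have "4 * j + 1 < n * 4" using j by simp
        then have "c < 4" using c npos by (metis mult_less_cancel1)
        then have "c = 0 \<or> c = 1 \<or> c = 2 \<or> c = 3" by auto
        then show False using c nl j by (elim disjE) (simp; presburger)+
      qed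
      then have "1 - q ^ (4 * j + 1) \<noteq> 0" using ord[of "4 * j + 1"] by simp
      then show ?case using step[of j] Suc j by (simp add: j_def[symmetric])
    qed
    have all: "poly P (q ^ (4 * i)) = 0" if "i < n" for i
    proof (cases "i \<le> 3 * l")
      case False
      then have "n - i \<le> 3 * l" using nl that by linarith
      from down[OF this] show ?thesis using that by simp
    qed (use up in auto)
    \<comment> \<open>As n is odd, 4 is invertible modulo n, so the powers of q^4 give n distinct
      roots, more than the degree allows.\<close>
    have inj: "inj_on (\<lambda>i. q ^ (4 * i)) {..<n}"
    proof -
      have *: "q ^ (4 * i) \<noteq> q ^ (4 * j)" if "i < j" "j < n" for i j
      proof
        assume e: "q ^ (4 * i) = q ^ (4 * j)"
        have "q ^ (4 * j) = q ^ (4 * i) * q ^ (4 * (j - i))"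
          using that by (simp flip: power_add add: diff_mult_distrib2)
        then have "q ^ (4 * (j - i)) = 1" using e q by simp
        then have "n dvd 4 * (j - i)" using ord by blast
        moreover have "coprime n 4"
          using n(1) coprime_power_right_iff[of n 2 2] by (simp)
        ultimately have "n dvd j - i" by (simp add: coprime_dvd_mult_right_iff)
        then show False using that by (auto dest: dvd_imp_le)
      qed
      show ?thesis by (rule inj_onI) (metis * lessThan_iff linorder_neqE_nat)
    qed
    show ?thesis
    proof (rule ccontr)
      assume "P \<noteq> 0"
      then have "finite {x. poly P x = 0}" "card {x. poly P x = 0} \<le> degree P"
        by (simp_all add: poly_roots_finite card_poly_roots_bound)
      moreover have "(\<lambda>i. q ^ (4 * i)) ` {..<n} \<subseteq> {x. poly P x = 0}" using all by auto
      ultimately have "card ((\<lambda>i. q ^ (4 * i)) ` {..<n}) \<le> degree P"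
        using card_mono order_trans by blast
      then show False using deg card_image[OF inj] by simp
    qed
  next
    case False
    define l where "l = n div 4"
    have nl: "n = 4 * l + 3" using False n(1) unfolding l_def by presburger
    have rec: "(1 - q ^ (4 * j + 5)) * coeff P (Suc j) = q * (1 - q ^ (4 * j + 3)) * coeff P j"
        for j
    proof -
      have "coeff ([:q, - (q ^ 4):] * pcompose P [:0, q ^ 4:]) (Suc j) =
          coeff ([:1, - q:] * P) (Suc j)"
        unfolding eq ..
      then have "q * ((q^4) ^ Suc j * coeff P (Suc j)) - q^4 * ((q^4) ^ j * coeff P j) =
          coeff P (Suc j) - q * coeff P j"
        by (simp add: coeff_pcompose_linear del: power_Suc)
      moreover have "q * (q^4) ^ Suc j = q ^ (4 * j + 5)" "q^4 * (q^4)^j = q * q ^ (4 * j + 3)"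
        by (simp_all add: power_add power_mult eval_nat_numeral mult_ac power_mult_distrib)
      ultimately have *: "q ^ (4 * j + 5) * coeff P (Suc j) - q * q ^ (4 * j + 3) * coeff P j =
          coeff P (Suc j) - q * coeff P j"
        by (metis mult.assoc)
      have "u * c' - q * v * c = c' - q * c \<Longrightarrow> (1 - u) * c' = q * (1 - v) * c"
          for u v c c' :: complex
        by (simp add: algebra_simps)
      from this[OF *] show ?thesis .
    qed
    have c0: "coeff P 0 = 0"
    proof -
      have "coeff ([:q, - (q ^ 4):] * pcompose P [:0, q ^ 4:]) 0 = coeff ([:1, - q:] * P) 0"
        unfolding eq ..
      then have "(1 - q) * coeff P 0 = 0"
          by (simp add: coeff_pcompose_linear poly_0_coeff_0 algebra_simps)
      moreover have "q ^ 1 \<noteq> 1" unfolding ord using n by simp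
      ultimately show ?thesis by simp
    qed
    \<comment> \<open>The factor 1 - q^{4j+5} first vanishes at j = 3l + 1, where 4j + 5 = 3n; in
      the downward run 1 - q^{4j+3} first vanishes at j = l, where 4j + 3 = n. The two runs again
      overlap.\<close>
    have up: "j \<le> 3 * l + 1 \<Longrightarrow> coeff P j = 0" for j
    proof (induction j)
      case 0
      then show ?case using c0 by simp
    next
      case (Suc j)
      have "\<not> n dvd 4 * j + 5"
      proof
        assume "n dvd 4 * j + 5"
        then obtain c where c: "4 * j + 5 = n * c" by (elim dvdE)
        have "4 * j + 5 < n * 3" using Suc.prems nl by simp
        then have "c < 3" using c npos by (metis mult_less_cancel1)
        then have "c = 0 \<or> c = 1 \<or> c = 2" by auto
        then show False using c nl by (elim disjE) (simp; presburger)+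
      qed
      then have "1 - q ^ (4 * j + 5) \<noteq> 0" using ord[of "4 * j + 5"] by simp
      then show ?case using rec[of j] Suc by simp
    qed
    have down: "i \<le> n - Suc l \<Longrightarrow> coeff P (n - i) = 0" for i
    proof (induction i)
      case 0
      then show ?case using deg by (simp add: coeff_eq_0)
    next
      case (Suc i)
      define j where "j = n - Suc i"
      have j: "n - i = Suc j" "j > l" "j < n" using Suc.prems nl by (auto simp: j_def)
      have "\<not> n dvd 4 * j + 3"
      proof
        assume "n dvd 4 * j + 3"
        then obtain c where c: "4 * j + 3 = n * c" by (elim dvdE)
        have "4 * j + 3 < n * 4" using j nl by simp
        then have "c < 4" using c npos by (metis mult_less_cancel1)
        then have "c = 0 \<or> c = 1 \<or> c = 2 \<or> c = 3" by auto
        then show False using c nl j by (elim disjE) (simp; presburger)+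
      qed
      then have "1 - q ^ (4 * j + 3) \<noteq> 0" using ord[of "4 * j + 3"] by simp
      then show ?case using rec[of j] Suc j q by (simp add: j_def[symmetric])
    qed
    have "coeff P j = 0" for j
    proof -
      consider "j \<le> 3 * l + 1" | "j > 3 * l + 1" "j < n" | "j \<ge> n" by linarith
      then show ?thesis
      proof cases
        case 2
        then show ?thesis using down[of "n - j"] nl by simp
      next
        case 3
        then show ?thesis using deg by (simp add: coeff_eq_0)
      qed (rule up)
    qed
    then show ?thesis by (intro poly_eqI) simp
  qed
qed

text \<open>This is a(1 - ac)(1 - c/a) as a polynomial in a. The shift of a by q^4 is not a
  substitution in x, so the functional equation needs this second form.\<close>

definition recip_factor :: "'a::comm_ring_1 \<Rightarrow> 'a poly" where
  "recip_factor c = [:1, - c:] * [:- c, 1:]"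

abbreviation cleared_poly_sym :: "'a::comm_ring_1 \<Rightarrow> nat \<Rightarrow> 'a poly" where
  "cleared_poly_sym \<equiv> cleared_sum recip_factor"

text \<open>Every summand has k odd and M - k completing factors of degree at most 2. With M = (n -
  1)/2 the bound is n - 1, just what \<open>functional_equation_imp_0\<close> requires.\<close>

lemma degree_cleared_poly_sym: "degree (cleared_poly_sym q M) \<le> 2 * M"
proof -
  have lin: "degree (recip_factor c) \<le> 2" for c :: 'a
    unfolding recip_factor_def by (rule order_trans[OF degree_mult_le]) simp
  have deg: "degree (\<Prod>i\<in>I. recip_factor (f i) :: 'a poly) \<le> 2 * card I" if "finite I"
      for f and I :: "nat set"
  proof -
    have "degree (\<Prod>i\<in>I. recip_factor (f i)) \<le> (\<Sum>i\<in>I. degree (recip_factor (f i)))"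
      using degree_prod_sum_le[OF that, of "\<lambda>i. recip_factor (f i)"] by (simp only: o_def)
    also have "\<dots> \<le> (\<Sum>i\<in>I. 2)" by (rule sum_mono) (rule lin)
    finally show ?thesis by simp
  qed
  have "degree (smult (cleared_coeff q M k) (odd_factors recip_factor q k *
      quad_factors recip_factor q M k)) \<le> 2 * M"
    if "k \<le> M" for k
  proof -
    have "degree (smult (cleared_coeff q M k) (odd_factors recip_factor q k *
        quad_factors recip_factor q M k))
       \<le> degree (odd_factors recip_factor q k * quad_factors recip_factor q M k)"
      by (rule degree_smult_le)
    also have "\<dots> \<le> degree (odd_factors recip_factor q k) + degree (quad_factors recip_factor q M k)"
      by (rule degree_mult_le)
    also have "\<dots> \<le> 2 * card {..<k} + 2 * card {k..<M}"
      unfolding odd_factors_def quad_factors_def by (intro add_mono deg) auto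
    also have "\<dots> = 2 * M" using that by simp
    finally show ?thesis .
  qed
  then show ?thesis
    unfolding cleared_sum_def by (intro degree_sum_le) auto
qed

lemma poly_cleared_poly_sym:
  fixes a :: "'a::field"
  assumes "a \<noteq> 0"
  shows "poly (cleared_poly_sym q M) a = a ^ M * poly (cleared_poly q M) ((1 - a) ^ 2 / a)"
proof -
  have f: "poly (recip_factor c) a = a * poly (sym_factor c) ((1 - a) ^ 2 / a)" for c
    unfolding poly_symmetric_factor[OF assms] recip_factor_def using assms
        by (simp add: field_simps)
  have "poly (smult (cleared_coeff q M k) (odd_factors recip_factor q k *
      quad_factors recip_factor q M k)) a
    = a ^ M * poly (smult (cleared_coeff q M k) (odd_factors sym_factor q k *
        quad_factors sym_factor q M k))
        ((1 - a) ^ 2 / a)" if "k \<le> M" for k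
  proof -
    have "a ^ M = a ^ k * a ^ (M - k)" using that by (simp flip: power_add)
    then show ?thesis
      unfolding odd_factors_def quad_factors_def poly_smult poly_mult poly_prod f prod.distrib
      by simp
  qed
  then show ?thesis
    unfolding cleared_sum_def poly_sum sum_distrib_left
    by (intro sum.cong refl) auto
qed

text \<open>For nonzero a with a^n different from 1 no denominator vanishes and
  \<open>qsum_shift\<close> applies; infinitely many such a give the polynomial identity.\<close>

lemma cleared_poly_sym_functional_equation:
  assumes prim: "q \<in> primitive_roots n" and n: "odd n" "n \<ge> 3" and M: "M = (n - 1) div 2"
  shows "[:q, - (q ^ 4):] * pcompose (cleared_poly_sym q M) [:0, q ^ 4:] =
      [:1, - q:] * cleared_poly_sym q M"
proof -
  have npos: "n > 0" using n by simp
  note ord = primitive_roots_power_eq_1[OF prim npos]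
  have q: "q \<noteq> 0" using primitive_roots_nonzero[OF prim npos] .
  have nM: "n = 2 * M + 1" using n M by (auto elim!: oddE)
  have M0: "M > 0" using nM n by simp
  have qn: "q ^ n = 1" using ord by simp
  have cop: "coprime n 2" "coprime n 4"
    using n(1) coprime_power_right_iff[of n 2 2] by simp_all
  have q24: "q ^ (2 * Suc i) \<noteq> 1" "q ^ (4 * Suc i) \<noteq> 1" if "i < Suc M" for i
  proof -
    have "\<not> n dvd Suc i" using that nM M0 by (auto dest!: dvd_imp_le)
    then show "q ^ (2 * Suc i) \<noteq> 1" "q ^ (4 * Suc i) \<noteq> 1"
      unfolding ord using cop by (simp_all only: coprime_dvd_mult_right_iff not_False_eq_True)
  qed
  define F where "F = cleared_poly_sym q M"
  have main: "(q - a * q ^ 4) * poly F (a * q ^ 4) = (1 - a * q) * poly F a"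
      if a: "a \<noteq> 0" "a ^ n \<noteq> 1" for a
  proof -
    have anz: "a * q ^ i \<noteq> 1" for i
    proof
      assume "a * q ^ i = 1"
      then have "(a * q ^ i) ^ n = 1" by simp
      then have "a ^ n * (q ^ n) ^ i = 1"
          by (simp add: power_mult_distrib mult.commute flip: power_mult)
      then show False using a qn by simp
    qed
    have anz': "a \<noteq> q ^ i" for i
    proof
      assume "a = q ^ i"
      then have "a ^ n = (q ^ n) ^ i" by (simp add: mult.commute flip: power_mult)
      then show False using a qn by simp
    qed
    have anz'': "a * q ^ 4 * q ^ (4 * i) \<noteq> 1" "a * q ^ 4 \<noteq> q ^ (4 * Suc i)" for i
      using anz[of "4 + 4 * i"] anz'[of "4 * i"] q by (simp_all add: power_add mult_ac)
    define S where "S = qsum q a (Suc M)"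
    define S' where "S' = qsum q (a * q ^ 4) (Suc M)"
    \<comment> \<open>The symbol (q;q^2)_{M+1} contains 1 - q^{2M+1} = 1 - q^n, which is 0 whatever
      a is.\<close>
    have tele0: "qtele q a (Suc M) = 0"
    proof -
      have "qpoch q (q^2) (Suc M) = 0"
        unfolding qpoch_eq_0_iff by (intro exI[of _ M])
            (use qn in \<open>simp add: nM power_mult power_mult_distrib\<close>)
      then show ?thesis by (simp add: qtele_def qcert_def)
    qed
    have "(1 - a * q) * (1 - a * q^3) * ((1 - a * q) * (1 - a * q^4) * S - q * (1 - a * q^3) *
        (1 - a) * S') = 0"
      unfolding S_def S'_def
      by (subst qsum_shift) (use q a anz anz' q24 tele0 in auto)
    moreover have nz: "1 - a * q \<noteq> 0" "1 - a * q^3 \<noteq> 0" "1 - a * q^4 \<noteq> 0" "1 - a \<noteq> 0"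
        "1 - a * q^2 \<noteq> 0"
      using anz[of 1] anz[of 3] anz[of 4] anz[of 0] anz[of 2] by simp_all
    ultimately have rec: "q * (1 - a * q^3) * (1 - a) * S' = (1 - a * q) * (1 - a * q^4) * S"
      by simp
    define E where "E = qpoch (q^2) (q^2) M * qpoch (q^4) (q^4) M"
    define w where "w = q ^ (4 * M)"
    \<comment> \<open>Since 4M + 2 = 2n, q^{4M} is the inverse of q^2. The end factors 1 - a
      q^{4M+4} and a - q^{4M} left by the shift therefore both become multiples of 1 - a q^2 and
      cancel.\<close>
    have w: "w * q ^ 2 = 1" "(q^4)^M = w"
    proof -
      have "w * q^2 = (q ^ n)^2" unfolding w_def nM
          by (simp add: power_mult[symmetric] power_add[symmetric] algebra_simps)
      then show "w * q^2 = 1" using qn by simp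
    qed (simp add: w_def power_mult)
    have Fa: "poly F a = a ^ M * (E * (qpoch (a * q^4) (q^4) M * qpoch (q^4 / a) (q^4) M) * S)"
      unfolding F_def poly_cleared_poly_sym[OF a(1)] E_def S_def
      by (subst poly_cleared_poly) (use a q24 anz anz' in auto)
    have a4: "a * q^4 \<noteq> 0" using a q by simp
    have e: "q^4 / (a * q^4) = 1 / a" using q by simp
    have Fa': "poly F (a * q^4) = (a * q^4) ^ M *
        (E * (qpoch (a * q^4 * q^4) (q^4) M * qpoch (1 / a) (q^4) M) * S')"
      unfolding F_def poly_cleared_poly_sym[OF a4] E_def S'_def
      by (subst poly_cleared_poly) (use a4 q24 anz'' anz''(1)[of "Suc _"] e in auto)
    have s1: "qpoch (a * q^4) (q^4) M * (1 - a * q^2) =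
        (1 - a * q^4) * qpoch (a * q^4 * q^4) (q^4) M"
    proof -
      have "a * q^4 * w = a * q^2 * (w * q^2)" by (simp add: eval_nat_numeral)
      then have *: "a * q^4 * w = a * q^2" unfolding w by simp
      show ?thesis using qpoch_shift[of "a * q^4" "q^4" M] unfolding w * .
    qed
    have s2: "w * qpoch (1 / a) (q^4) M * (1 - a * q^2) = (1 - a) * qpoch (q^4 / a) (q^4) M"
    proof -
      have "qpoch (1 / a) (q^4) M * (1 - 1 / a * w) = (1 - 1 / a) * qpoch (1 / a * q^4) (q^4) M"
        using qpoch_shift[of "1 / a" "q^4" M] unfolding w .
      then have "qpoch (1 / a) (q^4) M * (a - w) = (a - 1) * qpoch (q^4 / a) (q^4) M"
        using a(1) by (simp add: field_simps)
      moreover have "a - w = - (w * (1 - a * q^2))" using w(1) by (simp add: algebra_simps)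
      ultimately show ?thesis by (simp add: algebra_simps)
    qed
    have shift: "(1 - a * q^4) * poly F (a * q^4) =
        (1 - a) * (a ^ M * (E * (qpoch (a * q^4) (q^4) M * qpoch (q^4 / a) (q^4) M) * S'))"
    proof -
      have "(1 - a * q^2) * ((1 - a * q^4) * poly F (a * q^4)) =
         a ^ M * E * ((1 - a * q^4) * qpoch (a * q^4 * q^4) (q^4) M) *
             (w * qpoch (1 / a) (q^4) M * (1 - a * q^2)) * S'"
        unfolding Fa' power_mult_distrib w by simp
      also have "\<dots> = (1 - a * q^2) * ((1 - a) *
          (a ^ M * (E * (qpoch (a * q^4) (q^4) M * qpoch (q^4 / a) (q^4) M) * S')))"
        unfolding s1[symmetric] s2 by simp
      finally show ?thesis using nz by simp
    qed
    have "(1 - a * q^4) * (q * (1 - a * q^3) * poly F (a * q^4)) =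
        a ^ M * (E * (qpoch (a * q^4) (q^4) M * qpoch (q^4 / a) (q^4) M)) *
            (q * (1 - a * q^3) * (1 - a) * S')"
      using shift by (simp add: mult_ac)
    also have "\<dots> = (1 - a * q^4) * ((1 - a * q) * poly F a)"
      unfolding rec Fa by simp
    finally have "q * (1 - a * q^3) * poly F (a * q^4) = (1 - a * q) * poly F a"
      using nz by simp
    moreover have "q * (1 - a * q^3) = q - a * q^4" by (simp add: algebra_simps eval_nat_numeral)
    ultimately show ?thesis by simp
  qed
  have "[:q, - (q ^ 4):] * pcompose F [:0, q ^ 4:] - [:1, - q:] * F = 0" (is "?D = 0")
  proof (rule ccontr)
    assume "?D \<noteq> 0"
    then have "finite {x. poly ?D x = 0}" by (rule poly_roots_finite)
    moreover have "finite {x::complex. x ^ n = 1}" using finite_roots_unity[of n] n by simp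
    ultimately have fin: "finite (insert 0 ({x. poly ?D x = 0} \<union> {x. x ^ n = 1}))" by simp
    have "insert 0 ({x. poly ?D x = 0} \<union> {x. x ^ n = 1}) = UNIV"
      using main by (auto simp: poly_pcompose left_diff_distrib mult.assoc)
    with fin show False using infinite_UNIV_char_0[where 'a = complex] by metis
  qed
  then show ?thesis by (simp add: F_def)
qed

text \<open>Take a root a of a^2 - (2 + x) a + 1. This surjectivity carries vanishing in the
  variable a over to the variable x.\<close>

lemma exists_symmetric_parameter:
  fixes x :: complex
  obtains a where "a \<noteq> 0" "x = (1 - a) ^ 2 / a"
proof -
  define s where "s = csqrt ((2 + x) ^ 2 - 4)"
  define a where "a = (2 + x + s) / 2"
  have s: "s ^ 2 = (2 + x) ^ 2 - 4" by (simp add: s_def)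
  have s2: "s = 2 * a - (2 + x)" by (simp add: a_def field_simps)
  have "4 * (a * (2 + x - a)) = (2 + x) ^ 2 - s ^ 2" unfolding s2 by algebra
  then have prod: "a * (2 + x - a) = 1" unfolding s by simp
  then have a0: "a \<noteq> 0" by auto
  have "(1 - a) ^ 2 = x * a" using prod by algebra
  then show ?thesis using a0 that[of a] by simp
qed

lemma cleared_poly_eq_0:
  assumes prim: "q \<in> primitive_roots n" and n: "odd n" "n \<ge> 3" and M: "M = (n - 1) div 2"
    and P0: "poly (cleared_poly q M) 0 = 0"
  shows "cleared_poly q M = 0"
proof -
  have sym: "cleared_poly_sym q M = 0"
  proof (rule functional_equation_imp_0[OF prim n _
      cleared_poly_sym_functional_equation[OF prim n M]])
    show "degree (cleared_poly_sym q M) < n"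
      using degree_cleared_poly_sym[of q M] n M by (auto elim!: oddE)
    show "poly (cleared_poly_sym q M) 1 = 0"
      using P0 by (subst poly_cleared_poly_sym) auto
  qed
  have "poly (cleared_poly q M) x = 0" for x
  proof -
    obtain a where "a \<noteq> 0" "x = (1 - a) ^ 2 / a" by (rule exists_symmetric_parameter)
    then show ?thesis using poly_cleared_poly_sym[of a q M] sym by simp
  qed
  then show ?thesis using poly_all_0_iff_0 by blast
qed

section \<open>Order of vanishing at a complex number\<close>

abbreviation cpoly :: "rat poly \<Rightarrow> complex poly" where
  "cpoly \<equiv> map_poly of_rat"

definition ceval :: "complex \<Rightarrow> rat poly \<Rightarrow> complex" where
  "ceval z p = poly (cpoly p) z"

lemma cpoly_uminus: "cpoly (- p) = - cpoly p"
  by (rule poly_eqI) (simp add: coeff_map_poly of_rat_minus)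

lemma cpoly_eq_0_iff: "cpoly p = 0 \<longleftrightarrow> p = 0"
  by (simp add: map_poly_eq_0_iff)

lemma degree_cpoly: "degree (cpoly p) = degree p"
  by (cases "p = 0") (auto intro: map_poly_degree_eq)

lemma ceval_simps [simp]:
  "ceval z 0 = 0" "ceval z 1 = 1" "ceval z (p + r) = ceval z p + ceval z r"
      "ceval z (p * r) = ceval z p * ceval z r"
  "ceval z (- p) = - ceval z p" "ceval z (p - r) = ceval z p - ceval z r" "ceval z [:0, 1:] = z"
proof -
  show add: "ceval z (p + r) = ceval z p + ceval z r" for p r
    by (simp add: ceval_def map_poly_of_rat_add)
  show neg: "ceval z (- p) = - ceval z p" for p
    by (simp add: ceval_def cpoly_uminus)
  show "ceval z (p - r) = ceval z p - ceval z r" using add[of p "- r"] neg[of r] by simp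
  show "ceval z [:0, 1:] = z" by (simp add: ceval_def map_poly_pCons)
qed (simp_all add: ceval_def map_poly_of_rat_mult)

lemma ceval_power [simp]: "ceval z (p ^ k) = ceval z p ^ k"
  by (induction k) simp_all

lemma ceval_sum: "ceval z (\<Sum>i\<in>I. f i) = (\<Sum>i\<in>I. ceval z (f i))"
  by (induction I rule: infinite_finite_induct) simp_all

lemma ceval_prod: "ceval z (\<Prod>i\<in>I. f i) = (\<Prod>i\<in>I. ceval z (f i))"
  by (induction I rule: infinite_finite_induct) simp_all

lemma to_fract_power [simp]: "to_fract (p ^ k) = to_fract p ^ k"
  by (induction k) simp_all

lemma to_fract_prod: "to_fract (\<Prod>i\<in>I. f i) = (\<Prod>i\<in>I. to_fract (f i))"
  by (induction I rule: infinite_finite_induct) simp_all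

text \<open>Membership in the k-th power of the maximal ideal of the local ring at \<open>z\<close>;
  \<open>k = 0\<close> says that \<open>f\<close> is regular at \<open>z\<close>.\<close>

definition vanishes :: "complex \<Rightarrow> nat \<Rightarrow> rat poly fract \<Rightarrow> bool" where
  "vanishes z k f \<longleftrightarrow>
     (\<exists>u v. f = to_fract u / to_fract v \<and> ceval z v \<noteq> 0 \<and> [:- z, 1:] ^ k dvd cpoly u)"

lemma vanishes_divideI:
  "ceval z v \<noteq> 0 \<Longrightarrow> [:- z, 1:] ^ k dvd cpoly u \<Longrightarrow> vanishes z k (to_fract u / to_fract v)"
  unfolding vanishes_def by blast

lemma vanishes_to_fract: "vanishes z 0 (to_fract p)"
  using vanishes_divideI[of z 1 0 p] by simp

lemma vanishes_inverse: "ceval z p \<noteq> 0 \<Longrightarrow> vanishes z 0 (1 / to_fract p)"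
  using vanishes_divideI[of z p 0 1] by simp

lemma vanishes_1_to_fract: "ceval z p = 0 \<Longrightarrow> vanishes z 1 (to_fract p)"
  using vanishes_divideI[of z 1 1 p] by (simp add: ceval_def poly_eq_0_iff_dvd)

lemma vanishes_1_imp_ev_0:
  assumes "vanishes z 1 (to_fract p)"
  shows "ceval z p = 0"
proof -
  obtain u v where uv: "to_fract p = to_fract u / to_fract v" "ceval z v \<noteq> 0"
      "[:- z, 1:] dvd cpoly u"
    using assms by (auto simp: vanishes_def)
  then have "v \<noteq> 0" by auto
  then have "to_fract (p * v) = to_fract u" using uv by simp
  then have "u = p * v" by (simp only: to_fract_eq_iff)
  moreover have "ceval z u = 0" using uv(3) by (simp add: ceval_def poly_eq_0_iff_dvd)
  ultimately show ?thesis using uv by simp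
qed

lemma vanishes_0 [simp]: "vanishes z k 0"
  using vanishes_divideI[of z 1 k 0] by simp

lemma vanishes_mono: "vanishes z k f \<Longrightarrow> l \<le> k \<Longrightarrow> vanishes z l f"
  unfolding vanishes_def using le_imp_power_dvd[of l k "[:- z, 1:]"] dvd_trans by blast

lemma vanishes_mult:
  assumes "vanishes z k f" "vanishes z l g"
  shows "vanishes z (k + l) (f * g)"
proof -
  obtain u v where f: "f = to_fract u / to_fract v" "ceval z v \<noteq> 0" "[:- z, 1:] ^ k dvd cpoly u"
    using assms(1) by (auto simp: vanishes_def)
  obtain u' v' where g: "g = to_fract u' / to_fract v'" "ceval z v' \<noteq> 0"
      "[:- z, 1:] ^ l dvd cpoly u'"
    using assms(2) by (auto simp: vanishes_def)
  have "f * g = to_fract (u * u') / to_fract (v * v')"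
    using f g by simp
  moreover have "[:- z, 1:] ^ (k + l) dvd cpoly (u * u')"
    unfolding power_add map_poly_of_rat_mult using f g by (intro mult_dvd_mono)
  moreover have "ceval z (v * v') \<noteq> 0" using f(2) g(2) by simp
  ultimately show ?thesis unfolding vanishes_def by blast
qed

lemma vanishes_add:
  assumes "vanishes z k f" "vanishes z k g"
  shows "vanishes z k (f + g)"
proof -
  obtain u v where f: "f = to_fract u / to_fract v" "ceval z v \<noteq> 0" "[:- z, 1:] ^ k dvd cpoly u"
    using assms(1) by (auto simp: vanishes_def)
  obtain u' v' where g: "g = to_fract u' / to_fract v'" "ceval z v' \<noteq> 0"
      "[:- z, 1:] ^ k dvd cpoly u'"
    using assms(2) by (auto simp: vanishes_def)
  have "v \<noteq> 0" "v' \<noteq> 0" using f g by auto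
  then have "f + g = to_fract (u * v' + u' * v) / to_fract (v * v')"
    using f g by (simp add: field_simps)
  moreover have "[:- z, 1:] ^ k dvd cpoly (u * v' + u' * v)"
    unfolding map_poly_of_rat_add map_poly_of_rat_mult using f g by (intro dvd_add dvd_mult2)
  moreover have "ceval z (v * v') \<noteq> 0" using f(2) g(2) by simp
  ultimately show ?thesis unfolding vanishes_def by blast
qed

lemma vanishes_uminus: "vanishes z k f \<Longrightarrow> vanishes z k (- f)"
  using vanishes_mult[of z k f 0 "to_fract (- 1)"] vanishes_to_fract[of z "- 1"] by simp

lemma vanishes_diff: "vanishes z k f \<Longrightarrow> vanishes z k g \<Longrightarrow> vanishes z k (f - g)"
  using vanishes_add[of z k f "- g"] vanishes_uminus by simp

lemma vanishes_sum: "(\<And>i. i \<in> I \<Longrightarrow> vanishes z k (f i)) \<Longrightarrow> vanishes z k (\<Sum>i\<in>I. f i)"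
  by (induction I rule: infinite_finite_induct) (auto intro: vanishes_add)

lemma vanishes_mult_left: "vanishes z 0 f \<Longrightarrow> vanishes z k g \<Longrightarrow> vanishes z k (f * g)"
  using vanishes_mult[of z 0 f k g] by simp

lemma vanishes_power: "vanishes z k f \<Longrightarrow> vanishes z (k * m) (f ^ m)"
proof (induction m)
  case 0
  then show ?case using vanishes_to_fract[of z 1] by simp
next
  case (Suc m)
  then show ?case using vanishes_mult[of z k f "k * m" "f ^ m"] by simp
qed

lemma vanishes_mult_cancel_unit:
  assumes "ceval z p \<noteq> 0" "vanishes z k (to_fract p * f)"
  shows "vanishes z k f"
proof -
  have "p \<noteq> 0" using assms by auto
  then have "f = 1 / to_fract p * (to_fract p * f)" by simp
  then show ?thesis using vanishes_mult_left[OF vanishes_inverse[OF assms(1)] assms(2)] by simp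
qed

text \<open>The remainder of \<open>r\<close> modulo \<open>p\<close> stays a multiple of
  \<open>p\<close> over the complex numbers, and its degree forces it to be 0.\<close>

lemma cpoly_dvd_imp_dvd:
  assumes "cpoly p dvd cpoly r" "p \<noteq> 0"
  shows "p dvd r"
proof -
  obtain t where t: "cpoly r = cpoly p * t" using assms by (elim dvdE)
  have "cpoly r = cpoly (p * (r div p) + r mod p)" by simp
  then have "cpoly (r mod p) = cpoly p * (t - cpoly (r div p))"
    unfolding map_poly_of_rat_add map_poly_of_rat_mult t by (simp add: algebra_simps)
  moreover have "degree (r mod p) < degree p \<or> r mod p = 0"
    using degree_mod_less[OF assms(2)] by auto
  ultimately have "r mod p = 0"
    using assms(2) degree_mult_eq[of "cpoly p" "t - cpoly (r div p)"]
    by (metis cpoly_eq_0_iff degree_cpoly le_add1 mult_zero_right not_le)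
  then show ?thesis by auto
qed

lemma prod_linear_powers_dvd:
  fixes P :: "complex poly"
  assumes "finite S" "\<And>z. z \<in> S \<Longrightarrow> [:- z, 1:] ^ e z dvd P"
  shows "(\<Prod>z\<in>S. [:- z, 1:] ^ e z) dvd P"
  using assms
proof (induction S rule: finite_induct)
  case empty
  then show ?case by simp
next
  case (insert x S)
  show ?case
  proof (cases "P = 0")
    case False
    let ?Q = "\<Prod>z\<in>S. [:- z, 1:] ^ e z"
    have "?Q dvd P" using insert by simp
    then obtain R where R: "P = ?Q * R" by (elim dvdE)
    have "poly ?Q x \<noteq> 0" using insert(1,2) by (auto simp: poly_prod)
    then have "order x ?Q = 0" by (simp add: order_0I)
    then have "order x P = order x R" using False R by (simp add: order_mult)
    then have "[:- x, 1:] ^ e x dvd R"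
      using insert.prems[of x] False R by (simp add: order_divides)
    then show ?thesis using insert(1,2) R by (simp add: mult.commute mult_dvd_mono)
  qed simp
qed

text \<open>The fraction witnessing \<open>vanishes\<close> may depend on \<open>z\<close>; the
  reduced one serves all \<open>z\<close> at once, as a single divisibility demands. By Bezout its
  numerator and denominator share no complex zero.\<close>

lemma vanishes_quot_of_fract:
  assumes "vanishes z k f"
  shows "ceval z (snd (quot_of_fract f)) \<noteq> 0" "[:- z, 1:] ^ k dvd cpoly (fst (quot_of_fract f))"
proof -
  define U where "U = fst (quot_of_fract f)"
  define V where "V = snd (quot_of_fract f)"
  obtain u v where f: "f = to_fract u / to_fract v" "ceval z v \<noteq> 0" "[:- z, 1:] ^ k dvd cpoly u"
    using assms by (auto simp: vanishes_def)
  have "v \<noteq> 0" using f by auto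
  have "V \<noteq> 0" by (simp add: V_def)
  have "f = to_fract U / to_fract V"
    unfolding U_def V_def by (simp flip: Fract_conv_to_fract)
  then have "to_fract (U * v) = to_fract (u * V)"
    using f \<open>v \<noteq> 0\<close> \<open>V \<noteq> 0\<close> by (simp add: field_simps)
  then have eq: "U * v = u * V" by (simp only: to_fract_eq_iff)
  have cop: "coprime U V" unfolding U_def V_def by (rule coprime_quot_of_fract)
  show V: "ceval z V \<noteq> 0"
  proof
    assume V0: "ceval z V = 0"
    have "ceval z U * ceval z v = ceval z u * ceval z V" using arg_cong[OF eq, of "ceval z"] by simp
    then have U0: "ceval z U = 0" using V0 f(2) by simp
    obtain a b where "a * U + b * V = 1"
      using cop by (metis bezout_coefficients_fst_snd coprime_imp_gcd_eq_1)
    then have "ceval z (a * U + b * V) = 1" by simp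
    then show False using U0 V0 by simp
  qed
  show "[:- z, 1:] ^ k dvd cpoly U"
  proof (cases "U = 0")
    case False
    have nz: "cpoly U * cpoly v \<noteq> 0" using False \<open>v \<noteq> 0\<close> by (simp add: cpoly_eq_0_iff)
    have "[:- z, 1:] ^ k dvd cpoly (U * v)" unfolding eq map_poly_of_rat_mult using f(3) by simp
    then have "k \<le> order z (cpoly U * cpoly v)"
      using nz by (simp add: order_divides map_poly_of_rat_mult)
    moreover have "order z (cpoly v) = 0" using f(2) by (simp add: order_0I ceval_def)
    ultimately show ?thesis using nz by (simp add: order_mult order_divides)
  qed simp
qed


lemma qint_conv_to_fract: "qint n = to_fract (\<Sum>i<n. [:0, 1:] ^ i)"
proof -
  have "(1 - [:0, 1:]) * (\<Sum>i<n. [:0, 1:] ^ i) = 1 - ([:0, 1:] :: rat poly) ^ n"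
    by (simp add: one_diff_power_eq)
  then have "to_fract ((1 - [:0, 1:]) * (\<Sum>i<n. [:0, 1:] ^ i)) =
      to_fract (1 - ([:0, 1:] :: rat poly) ^ n)"
    by (rule arg_cong)
  then have "(1 - qvar) * to_fract (\<Sum>i<n. [:0, 1:] ^ i) = 1 - qvar ^ n"
    by (simp only: to_fract_mult to_fract_diff to_fract_1 to_fract_power)
  moreover have "1 - qvar \<noteq> 0"
    by (simp flip: to_fract_1 to_fract_diff) (simp add: one_pCons)
  ultimately show ?thesis
    unfolding qint_def by (simp add: field_simps)
qed

text \<open>The zeros of the modulus are exactly the n-th roots of unity other than 1, triple at the
  primitive ones and simple at the rest. The local orders thus give both divisibility of the reduced
  numerator and coprimality of the reduced denominator.\<close>

lemma ratfun_cong_if_vanishes: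
  assumes n: "n > 1"
    and van: "\<And>z. z ^ n = 1 \<Longrightarrow> z \<noteq> 1 \<Longrightarrow> vanishes z 1 (A - B)"
    and prim: "\<And>z. z \<in> primitive_roots n \<Longrightarrow> vanishes z 3 (A - B)"
  shows "ratfun_cong A B (qint n * to_fract (cyclotomic n) ^ 2)"
proof -
  define N :: "rat poly" where "N = (\<Sum>i<n. [:0, 1:] ^ i)"
  define p where "p = N * cyclotomic n ^ 2"
  define U where "U = fst (quot_of_fract (A - B))"
  define V where "V = snd (quot_of_fract (A - B))"
  have P: "qint n * to_fract (cyclotomic n) ^ 2 = to_fract p"
    by (simp add: p_def N_def qint_conv_to_fract del: to_fract_sum)
  have N: "(1 - [:0, 1:]) * N = 1 - [:0, 1:] ^ n"
    by (simp add: N_def one_diff_power_eq)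
  have evN: "(1 - z) * ceval z N = 1 - z ^ n" for z
    using arg_cong[OF N, of "ceval z"] by simp
  have prim_sub: "z ^ n = 1" "z \<noteq> 1" if "z \<in> primitive_roots n" for z
    using that n by (auto simp: primitive_roots_def)
  have evC: "ceval z (cyclotomic n) = 0 \<longleftrightarrow> z \<in> primitive_roots n" for z
    unfolding ceval_def cyclotomic_primitive_roots[OF order_less_trans[OF zero_less_one n]]
    using finite_primitive_roots[of n] n by (simp add: poly_prod)
  have p_root: "z ^ n = 1 \<and> z \<noteq> 1" if "ceval z p = 0" for z
  proof -
    have "ceval z N = 0 \<or> ceval z (cyclotomic n) = 0" using that by (simp add: p_def)
    then show ?thesis
    proof
      assume "ceval z N = 0"
      \<comment> \<open>[n] takes the value n at q = 1, so 1 is not among its roots.\<close>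
      moreover have "ceval 1 N = of_nat n" by (simp add: N_def ceval_sum)
      ultimately show ?thesis using evN[of z] n by auto
    qed (use prim_sub evC in auto)
  qed
  have V0: "V \<noteq> 0" by (simp add: V_def)
  have p0: "p \<noteq> 0" using p_root[of 1] by auto
  have cop: "coprime V p"
  proof (rule ccontr)
    assume "\<not> coprime V p"
    then obtain g where g: "g dvd V" "g dvd p" "\<not> is_unit g" by (auto simp: coprime_def)
    have "g \<noteq> 0" using g V0 by auto
    then have "degree g \<noteq> 0" using g(3) by (simp add: is_unit_iff_degree)
    then have "\<not> constant (poly (cpoly g))" by (simp add: constant_degree degree_cpoly)
    then obtain z where z: "poly (cpoly g) z = 0" using fundamental_theorem_of_algebra by blast
    have "ceval z V = 0" "ceval z p = 0" using g(1,2) z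
        by (auto elim!: dvdE simp: ceval_def map_poly_of_rat_mult)
    then show False
      using vanishes_quot_of_fract(1)[OF van, of z] p_root[of z] by (simp add: V_def)
  qed
  have "cpoly p dvd cpoly U"
  proof -
    define S where "S = {z::complex. z ^ n = 1}"
    define e where "e z = (if z \<in> primitive_roots n then 3 else 1 :: nat)" for z
    have fin: "finite S" unfolding S_def using finite_roots_unity[of n] n by simp
    have sub: "primitive_roots n \<subseteq> S" using prim_sub by (auto simp: S_def)
    \<comment> \<open>Multiplying by q - 1 supplies the missing root 1, so that the product over all
      n-th roots becomes (q^n - 1) Phi_n^2; the factor is cancelled at the end.\<close>
    have "[:- z, 1:] ^ e z dvd [:- 1, 1:] * cpoly U" if "z \<in> S" for z
    proof (cases "z = 1")
      case True
      then have "z \<notin> primitive_roots n" using prim_sub by auto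
      then have "[:- z, 1:] ^ e z = [:- 1, 1:]" using True by (simp add: e_def)
      then show ?thesis by (simp only: dvd_triv_left)
    next
      case False
      have "vanishes z (e z) (A - B)"
        using prim van that False by (auto simp: e_def S_def)
      then have "[:- z, 1:] ^ e z dvd cpoly U" unfolding U_def by (rule vanishes_quot_of_fract(2))
      then show ?thesis by (rule dvd_mult)
    qed
    then have "(\<Prod>z\<in>S. [:- z, 1:] ^ e z) dvd [:- 1, 1:] * cpoly U"
      by (rule prod_linear_powers_dvd[OF fin])
    moreover have "(\<Prod>z\<in>S. [:- z, 1:] ^ e z) =
        (\<Prod>z\<in>S. [:- z, 1:]) * (\<Prod>z\<in>primitive_roots n. [:- z, 1:]) ^ 2"
    proof -
      have "(\<Prod>z\<in>S. [:- z, 1:] ^ e z) = (\<Prod>z\<in>S. [:- z, 1:] *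
          (if z \<in> primitive_roots n then [:- z, 1:] ^ 2 else 1))"
        by (rule prod.cong) (auto simp: e_def power_Suc[symmetric] eval_nat_numeral simp del:
            mult_pCons_left)
      also have "\<dots> = (\<Prod>z\<in>S. [:- z, 1:]) *
          (\<Prod>z\<in>S. if z \<in> primitive_roots n then [:- z, 1:] ^ 2 else 1)"
        by (rule prod.distrib)
      also have "(\<Prod>z\<in>S. if z \<in> primitive_roots n then [:- z, 1:] ^ 2 else 1) =
          (\<Prod>z\<in>S \<inter> primitive_roots n. [:- z, 1:] ^ 2)"
        by (rule prod.inter_restrict[OF fin, symmetric])
      also have "S \<inter> primitive_roots n = primitive_roots n" using sub by auto
      finally show ?thesis by (simp only: prod_power_distrib)
    qed
    moreover have "(\<Prod>z\<in>S. [:- z, 1:]) = [:- 1, 1:] * cpoly N"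
    proof -
      have "(\<Prod>z\<in>S. [:- z, 1:]) = monom 1 n - 1"
        unfolding S_def using monom_minus_one_roots[of n] n by simp
      also have "\<dots> = [:0, 1:] ^ n - 1" by (simp add: monom_altdef)
      also have "\<dots> = [:- 1, 1:] * cpoly N"
      proof -
        have x: "cpoly [:0, 1:] = [:0, 1:]" by (simp add: map_poly_pCons)
        have xp: "cpoly ([:0, 1:] ^ k) = [:0, 1:] ^ k" for k
          by (induction k) (simp_all only: power_0 power_Suc map_poly_of_rat_mult x, simp)
        have "cpoly N = (\<Sum>i<n. [:0, 1:] ^ i)"
          unfolding N_def xp[symmetric] by (rule poly_eqI)
              (simp add: coeff_map_poly coeff_sum of_rat_sum)
        moreover have "[:- 1, 1:] = [:0, 1:] - (1 :: complex poly)" by (simp add: one_pCons)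
        ultimately show ?thesis by (simp only: power_diff_1_eq)
      qed
      finally show ?thesis .
    qed
    moreover have "(\<Prod>z\<in>primitive_roots n. [:- z, 1:]) = cpoly (cyclotomic n)"
      using cyclotomic_primitive_roots[of n] n by simp
    moreover have "cpoly p = cpoly N * cpoly (cyclotomic n) ^ 2"
      by (simp add: p_def power2_eq_square map_poly_of_rat_mult)
    ultimately have "[:- 1, 1:] * cpoly p dvd [:- 1, 1:] * cpoly U"
      by (simp only: mult.assoc)
    then show ?thesis by (simp only: dvd_mult_cancel_left) auto
  qed
  then have "p dvd U" by (rule cpoly_dvd_imp_dvd[OF _ p0])
  then obtain w where w: "U = p * w" by (elim dvdE)
  have "A - B = to_fract U / to_fract V"
    unfolding U_def V_def by (simp flip: Fract_conv_to_fract)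
  then have "A - B = to_fract p * Fract w V"
    by (simp add: w Fract_conv_to_fract)
  then show ?thesis
    unfolding ratfun_cong_def P using V0 cop by blast
qed

section \<open>The congruence at primitive roots of unity\<close>

text \<open>Instantiated by the embedding of Q[q] into the rational functions and by evaluation at
  \<open>z\<close>; through both images of one cleared polynomial the generic sum is tied to its
  specialisation.\<close>

locale comm_ring_hom =
  fixes h :: "'a::comm_ring_1 \<Rightarrow> 'b::comm_ring_1"
  assumes hom_1: "h 1 = 1" and hom_add: "h (x + y) = h x + h y" and hom_mult:
      "h (x * y) = h x * h y"
begin

lemma hom_0 [simp]: "h 0 = 0"
  using hom_add[of 0 0] by simp

lemma hom_uminus: "h (- x) = - h x"
  using hom_add[of "- x" x] by (simp add: eq_neg_iff_add_eq_0)

lemma hom_diff: "h (x - y) = h x - h y"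
  using hom_add[of x "- y"] by (simp add: hom_uminus)

lemma hom_power: "h (x ^ k) = h x ^ k"
  by (induction k) (simp_all add: hom_1 hom_mult)

lemma hom_sum: "h (\<Sum>i\<in>I. f i) = (\<Sum>i\<in>I. h (f i))"
  by (induction I rule: infinite_finite_induct) (simp_all add: hom_add)

lemma hom_prod: "h (\<Prod>i\<in>I. f i) = (\<Prod>i\<in>I. h (f i))"
  by (induction I rule: infinite_finite_induct) (simp_all add: hom_mult hom_1)

lemma hom_qpoch: "h (qpoch a b k) = qpoch (h a) (h b) k"
  by (simp add: qpoch_def hom_prod hom_diff hom_mult hom_power hom_1)

lemma map_poly_hom_add: "map_poly h (p + r) = map_poly h p + map_poly h r"
  by (rule poly_eqI) (simp add: coeff_map_poly hom_add)

lemma map_poly_hom_mult: "map_poly h (p * r) = map_poly h p * map_poly h r"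
  by (rule poly_eqI) (simp add: coeff_map_poly coeff_mult hom_sum hom_mult)

lemma map_poly_hom_smult: "map_poly h (smult c p) = smult (h c) (map_poly h p)"
  by (rule poly_eqI) (simp add: coeff_map_poly hom_mult)

lemma map_poly_hom_sum: "map_poly h (\<Sum>i\<in>I. f i) = (\<Sum>i\<in>I. map_poly h (f i))"
  by (induction I rule: infinite_finite_induct) (simp_all add: map_poly_hom_add)

lemma map_poly_hom_prod: "map_poly h (\<Prod>i\<in>I. f i) = (\<Prod>i\<in>I. map_poly h (f i))"
  by (induction I rule: infinite_finite_induct) (simp_all add: map_poly_hom_mult hom_1)

lemma map_poly_sym_factor: "map_poly h (sym_factor c) = sym_factor (h c)"
  by (simp add: sym_factor_def map_poly_pCons hom_power hom_diff hom_uminus hom_1)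

lemma map_poly_quad_factors:
  "map_poly h (quad_factors sym_factor q M k) = quad_factors sym_factor (h q) M k"
  by (simp add: quad_factors_def map_poly_hom_prod map_poly_sym_factor hom_power hom_mult)

lemma map_poly_cleared_poly: "map_poly h (cleared_poly q M) = cleared_poly (h q) M"
proof -
  have "map_poly h (odd_factors sym_factor q k) = odd_factors sym_factor (h q) k" for k
    by (simp add: odd_factors_def map_poly_hom_prod map_poly_sym_factor hom_power hom_mult)
  moreover have "h (cleared_coeff q M k) = cleared_coeff (h q) M k" for k
    by (simp add: cleared_coeff_def hom_mult hom_diff hom_1 hom_power hom_qpoch hom_prod)
  ultimately show ?thesis
    by (simp add: cleared_sum_def map_poly_hom_sum map_poly_hom_smult map_poly_hom_mult
        map_poly_quad_factors)
qed

end

interpretation to_fract: comm_ring_hom "to_fract :: rat poly \<Rightarrow> rat poly fract"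
  by standard simp_all

interpretation ceval: comm_ring_hom "ceval z"
  by standard simp_all

text \<open>p(x) - p(0) is x times a polynomial in x over Q[q], which is regular at \<open>z\<close>
  because x is.\<close>

lemma vanishes_poly_diff:
  assumes x: "vanishes z k x"
  shows "vanishes z k (poly (fract_poly p) x - to_fract (coeff p 0))"
proof -
  have int: "vanishes z 0 (poly (fract_poly r) x)" for r :: "rat poly poly"
    by (induction r) (auto simp: map_poly_pCons
        intro!: vanishes_add vanishes_to_fract vanishes_mult_left vanishes_mono[OF x])
  show ?thesis
  proof (cases p rule: pCons_cases)
    case (pCons c r)
    then have "poly (fract_poly p) x - to_fract (coeff p 0) = poly (fract_poly r) x * x"
      by (simp add: map_poly_pCons mult.commute)
    then show ?thesis using vanishes_mult_left[OF int x] by simp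
  qed
qed

text \<open>The cofactor of x agrees with \<open>coeff p 1\<close> up to a multiple of x, so a zero
  of that coefficient adds one order to the two of x.\<close>

lemma vanishes_poly_diff_3:
  assumes x: "vanishes z 2 x" and c1: "ceval z (coeff p 1) = 0"
  shows "vanishes z 3 (poly (fract_poly p) x - to_fract (coeff p 0))"
proof (cases p rule: pCons_cases)
  case (pCons c r)
  have "coeff r 0 = coeff p 1" using pCons by simp
  then have "vanishes z 1 (to_fract (coeff r 0))" using c1 vanishes_1_to_fract by metis
  moreover have "vanishes z 1 (poly (fract_poly r) x - to_fract (coeff r 0))"
    by (rule vanishes_poly_diff) (rule vanishes_mono[OF x], simp)
  ultimately have "vanishes z 1 (poly (fract_poly r) x)"
    using vanishes_add by fastforce
  from vanishes_mult[OF x this] show ?thesis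
    using pCons by (simp add: map_poly_pCons)
qed

lemma qvar_power_neq_1: "m > 0 \<Longrightarrow> qvar ^ m \<noteq> 1"
proof
  assume m: "m > 0" and "qvar ^ m = 1"
  then have "to_fract ([:0, 1:] ^ m :: rat poly) = to_fract 1" by simp
  then have "([:0, 1:] ^ m :: rat poly) = 1" by (simp only: to_fract_eq_iff)
  then have "ceval 0 ([:0, 1:] ^ m) = ceval 0 1" by (rule arg_cong)
  then show False using m by (simp add: power_0_left)
qed

lemma qvar_neq_0: "qvar \<noteq> 0"
  by simp

lemma vanishes_one_minus_power: "z ^ m = 1 \<Longrightarrow> vanishes z 1 (1 - qvar ^ m)"
  using vanishes_1_to_fract[of z "1 - [:0, 1:] ^ m"] by simp

lemma vanishes_inverse_qvar_power: "z \<noteq> 0 \<Longrightarrow> vanishes z 0 (1 / qvar ^ m)"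
  using vanishes_inverse[of z "[:0, 1:] ^ m"] by simp

lemma qpoch_qvar: "qpoch (qvar ^ a) (qvar ^ b) k = to_fract (qpoch ([:0, 1:] ^ a) ([:0, 1:] ^ b) k)"
  by (simp add: to_fract.hom_qpoch)

lemma ceval_qpoch: "ceval z (qpoch ([:0, 1:] ^ a) ([:0, 1:] ^ b) k) = qpoch (z ^ a) (z ^ b) k"
  by (simp add: ceval.hom_qpoch)

lemma qpoch_primitive_root_neq_0:
  assumes prim: "z \<in> primitive_roots n" and n: "odd n" and k: "k < n" and c: "c = 2 \<or> c = 4"
  shows "qpoch (z ^ c) (z ^ c) k \<noteq> 0"
proof
  assume "qpoch (z ^ c) (z ^ c) k = 0"
  then obtain i where i: "i < k" "z ^ (c * Suc i) = 1"
    by (auto simp: qpoch_eq_0_iff power_mult power_add)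
  then have "n dvd c * Suc i" using primitive_roots_power_eq_1[OF prim] n odd_pos by blast
  moreover have "coprime n c"
    using n c coprime_power_right_iff[of n 2 2] by auto
  ultimately have "n dvd Suc i" by (simp only: coprime_dvd_mult_right_iff)
  then show False using i k by (auto dest!: dvd_imp_le)
qed

text \<open>Evaluation at a = 1 and a = q^n gives p(0) = e r(0) S and p(x) = e r(x) R, hence e r(0)
  (S - R) = e (r(x) - r(0)) R - (p(x) - p(0)). The first part has order 2 + 1, the second order 3,
  and e r(0) is nonzero at \<open>z\<close>.\<close>

lemma qsum_vanishes_3:
  assumes prim: "z \<in> primitive_roots n" and n: "odd n" "n \<ge> 3" and M: "M = (n - 1) div 2"
    and val: "vanishes z 1 (qvalue qvar n)"
  shows "vanishes z 3 (qsum qvar 1 (Suc M) - qvalue qvar n)"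
proof -
  let ?X = "[:0, 1:] :: rat poly"
  have npos: "n > 0" using n by simp
  have z0: "z \<noteq> 0" using primitive_roots_nonzero[OF prim npos] .
  have zn: "z ^ n = 1" using prim by (simp add: primitive_roots_def)
  have nM: "n = 2 * M + 1" using n M by (auto elim!: oddE)
  define p where "p = cleared_poly ?X M"
  define r where "r = quad_factors sym_factor ?X M 0"
  define x where "x = (1 - qvar ^ n) ^ 2 / qvar ^ n"
  define e where "e = qpoch (?X ^ 2) (?X ^ 2) M * qpoch (?X ^ 4) (?X ^ 4) M"
  define R where "R = qvalue qvar n"
  define S where "S = qsum qvar 1 (Suc M)"
  have fp: "fract_poly p = cleared_poly qvar M" "fract_poly r = quad_factors sym_factor qvar M 0"
    unfolding p_def r_def by (rule to_fract.map_poly_cleared_poly to_fract.map_poly_quad_factors)+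
  have E: "qpoch (qvar ^ 2) (qvar ^ 2) M * qpoch (qvar ^ 4) (qvar ^ 4) M = to_fract e"
    by (simp add: e_def qpoch_qvar)
  have x: "vanishes z 2 x"
  proof -
    have "vanishes z 2 (1 / qvar ^ n * (1 - qvar ^ n) ^ 2)"
      using vanishes_power[OF vanishes_one_minus_power[OF zn], of 2]
      by (intro vanishes_mult_left vanishes_inverse_qvar_power z0) simp
    then show ?thesis by (simp add: x_def)
  qed
  have D: "qpoch (a * qvar ^ 4) (qvar ^ 4) M * qpoch (qvar ^ 4 / a) (qvar ^ 4) M =
      poly (fract_poly r) ((1 - a) ^ 2 / a)"
    if "a \<noteq> 0" for a
  proof -
    have pw: "a * qvar ^ 4 * (qvar ^ 4) ^ i = a * qvar ^ (4 * Suc i)"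
        "qvar ^ 4 / a * (qvar ^ 4) ^ i = qvar ^ (4 * Suc i) / a" for i
      by (simp_all add: power_mult[symmetric] power_add mult_ac)
    show ?thesis
      unfolding fp quad_factors_def poly_prod poly_symmetric_factor[OF that] prod.distrib
      unfolding qpoch_def lessThan_atLeast0 pw ..
  qed
  have nr: "qvar ^ (2 * Suc i) \<noteq> 1" "qvar ^ (4 * Suc i) \<noteq> 1" for i
    by (rule qvar_power_neq_1, simp)+
  have pn: "poly (fract_poly p) x = to_fract e * poly (fract_poly r) x * R"
  proof -
    have "qvar ^ n * qvar ^ (4 * Suc i) \<noteq> 1" for i
      unfolding power_add[symmetric] by (rule qvar_power_neq_1) simp
    moreover have "qvar ^ n \<noteq> qvar ^ (4 * Suc i)" for i
    proof -
      have "n \<noteq> 4 * Suc i" using n(1) by auto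
      then show ?thesis
        using power_inj_if_not_root_of_unity[OF qvar_neq_0 qvar_power_neq_1] by blast
    qed
    ultimately have "poly (cleared_poly qvar M) ((1 - qvar ^ n) ^ 2 / qvar ^ n) =
        qpoch (qvar ^ 2) (qvar ^ 2) M * qpoch (qvar ^ 4) (qvar ^ 4) M *
        (qpoch (qvar ^ n * qvar ^ 4) (qvar ^ 4) M * qpoch (qvar ^ 4 / qvar ^ n) (qvar ^ 4) M) *
        qsum qvar (qvar ^ n) (Suc M)"
      by (intro poly_cleared_poly nr) simp_all
    moreover have "qsum qvar (qvar ^ n) (Suc M) = R"
      unfolding R_def M by (rule qsum_power[OF qvar_neq_0 qvar_power_neq_1 n(1)])
    moreover have "qvar ^ n \<noteq> 0" by simp
    ultimately show ?thesis unfolding fp(1)[symmetric] x_def E D[OF \<open>qvar ^ n \<noteq> 0\<close>] by simp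
  qed
  have p0: "to_fract (coeff p 0) = to_fract e * to_fract (coeff r 0) * S"
  proof -
    have "poly (cleared_poly qvar M) ((1 - 1) ^ 2 / 1) =
      to_fract e * poly (fract_poly r) ((1 - 1) ^ 2 / 1) * S"
      unfolding S_def D[of 1, OF one_neq_zero, symmetric] E[symmetric]
      by (rule poly_cleared_poly) (use nr nr[symmetric] in \<open>simp_all del: power_Suc mult_Suc_right\<close>)
    then show ?thesis by (simp add: fp(1)[symmetric] poly_0_coeff_0 coeff_map_poly)
  qed
  have dn: "vanishes z 2 (poly (fract_poly r) x - to_fract (coeff r 0))"
    by (rule vanishes_poly_diff[OF x])
  have J0: "vanishes z 0 (poly (fract_poly r) x)"
    using vanishes_add[OF vanishes_mono[OF dn, of 0] vanishes_to_fract[of z "coeff r 0"]] by simp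
  \<comment> \<open>At \<open>z\<close> the points x and 0 coincide, so the zero of R passes to
    p(0). This is the input of \<open>cleared_poly_eq_0\<close>, which then kills the linear
    coefficient of p at \<open>z\<close>.\<close>
  have "vanishes z 1 (poly (fract_poly p) x)"
    unfolding pn R_def by (intro vanishes_mult_left val vanishes_to_fract J0)
  moreover have "vanishes z 1 (poly (fract_poly p) x - to_fract (coeff p 0))"
    by (rule vanishes_mono[OF vanishes_poly_diff[OF x]]) simp
  ultimately have "vanishes z 1 (to_fract (coeff p 0))"
    using vanishes_diff by fastforce
  then have "ceval z (coeff p 0) = 0" by (rule vanishes_1_imp_ev_0)
  moreover have evp: "map_poly (ceval z) p = cleared_poly z M"
    unfolding p_def by (subst ceval.map_poly_cleared_poly) simp
  ultimately have "poly (cleared_poly z M) 0 = 0"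
    by (simp add: evp[symmetric] poly_0_coeff_0 coeff_map_poly)
  then have "cleared_poly z M = 0" by (rule cleared_poly_eq_0[OF prim n M])
  then have "coeff (map_poly (ceval z) p) 1 = 0" by (simp add: evp)
  then have "ceval z (coeff p 1) = 0" by (simp add: coeff_map_poly)
  then have "vanishes z 3 (poly (fract_poly p) x - to_fract (coeff p 0))"
    by (rule vanishes_poly_diff_3[OF x])
  moreover have "vanishes z 3 (to_fract e * ((poly (fract_poly r) x - to_fract (coeff r 0)) * R))"
    using vanishes_mult_left[OF vanishes_to_fract vanishes_mult[OF dn val]] by (simp add: R_def)
  ultimately have "vanishes z 3 (to_fract e * ((poly (fract_poly r) x - to_fract (coeff r 0)) * R)
      - (poly (fract_poly p) x - to_fract (coeff p 0)))"
    by (rule vanishes_diff[rotated])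
  also have "to_fract e * ((poly (fract_poly r) x - to_fract (coeff r 0)) * R)
      - (poly (fract_poly p) x - to_fract (coeff p 0)) = to_fract (e * coeff r 0) * (S - R)"
    unfolding p0 pn by (simp add: algebra_simps)
  finally have "vanishes z 3 (to_fract (e * coeff r 0) * (S - R))" .
  moreover have "ceval z (e * coeff r 0) \<noteq> 0"
  proof -
    have u: "qpoch (z ^ 2) (z ^ 2) M \<noteq> 0" "qpoch (z ^ 4) (z ^ 4) M \<noteq> 0"
      using qpoch_primitive_root_neq_0[OF prim n(1)] nM by auto
    have "to_fract (coeff r 0) = qpoch (qvar ^ 4) (qvar ^ 4) M * qpoch (qvar ^ 4) (qvar ^ 4) M"
      using D[of 1] by (simp add: poly_0_coeff_0 coeff_map_poly)
    then have "to_fract (coeff r 0) = to_fract (qpoch (?X ^ 4) (?X ^ 4) M *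
        qpoch (?X ^ 4) (?X ^ 4) M)"
      by (simp add: qpoch_qvar)
    then have "coeff r 0 = qpoch (?X ^ 4) (?X ^ 4) M * qpoch (?X ^ 4) (?X ^ 4) M"
      by (simp only: to_fract_eq_iff)
    then show ?thesis using u by (simp add: e_def ceval_qpoch del: ceval_power)
  qed
  ultimately show ?thesis
    unfolding S_def R_def by (rule vanishes_mult_cancel_unit[rotated])
qed

section \<open>The congruence at roots of unity of smaller order\<close>

text \<open>If d divides m, then 1 - X^m is 1 - X^d times a geometric sum with value m/d at
  \<open>z\<close>; otherwise it is nonzero there. Orders at \<open>z\<close> thus become counts of
  multiples of d.\<close>

lemma prod_one_minus_power_factor:
  fixes f :: "'b \<Rightarrow> nat"
  assumes prim: "z \<in> primitive_roots d" and d: "d > 0" and I: "finite I" and f: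
      "\<And>i. i \<in> I \<Longrightarrow> f i > 0"
  obtains w where "ceval z w \<noteq> 0"
    "(\<Prod>i\<in>I. 1 - [:0, 1:] ^ f i) = (1 - [:0, 1:] ^ d) ^ card {i \<in> I. d dvd f i} * w"
proof -
  define X :: "rat poly" where "X = [:0, 1:]"
  have evX: "ceval z X = z" by (simp add: X_def)
  have "\<exists>w. ceval z w \<noteq> 0 \<and>
    (\<Prod>i\<in>I. 1 - X ^ f i) = (1 - X ^ d) ^ card {i \<in> I. d dvd f i} * w"
    using I f
  proof (induction I rule: finite_induct)
    case empty
    show ?case by (intro exI[of _ 1]) simp
  next
    case (insert x I)
    then obtain w where w: "ceval z w \<noteq> 0"
      "(\<Prod>i\<in>I. 1 - X ^ f i) = (1 - X ^ d) ^ card {i \<in> I. d dvd f i} * w"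
      by auto
    show ?case
    proof (cases "d dvd f x")
      case True
      then obtain c where c: "f x = d * c" by (elim dvdE)
      have "c > 0" using insert.prems[of x] c by (auto intro: gr0I)
      define g :: "rat poly" where "g = (\<Sum>l<c. (X ^ d) ^ l)"
      have g: "1 - X ^ f x = (1 - X ^ d) * g"
        unfolding c power_mult g_def by (rule one_diff_power_eq)
      have "ceval z g = of_nat c"
        using primitive_roots_power_eq_1[OF prim d, of d] by (simp add: g_def ceval_sum evX)
      then have "ceval z (g * w) \<noteq> 0" using w \<open>c > 0\<close> by simp
      moreover have "{i \<in> insert x I. d dvd f i} = insert x {i \<in> I. d dvd f i}" using True by auto
      then have "card {i \<in> insert x I. d dvd f i} = Suc (card {i \<in> I. d dvd f i})"
        using insert(1,2) by simp
      ultimately show ?thesis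
        using insert(1,2) by (intro exI[of _ "g * w"]) (simp add: g w(2) mult_ac)
    next
      case False
      then have "z ^ f x \<noteq> 1" using primitive_roots_power_eq_1[OF prim d] by simp
      then have "ceval z ((1 - X ^ f x) * w) \<noteq> 0" using w by (simp add: evX)
      moreover have "{i \<in> insert x I. d dvd f i} = {i \<in> I. d dvd f i}" using False by auto
      ultimately show ?thesis
        using insert(1,2) by (intro exI[of _ "(1 - X ^ f x) * w"]) (simp add: w(2) mult_ac)
    qed
  qed
  then show ?thesis using that unfolding X_def by blast
qed

lemma qpoch_factor:
  assumes prim: "z \<in> primitive_roots d" and d: "d > 0" and a: "a > 0"
  obtains w where "ceval z w \<noteq> 0"
    "qpoch (qvar ^ a) (qvar ^ b) k = (1 - qvar ^ d) ^ card {i. i < k \<and> d dvd a + b * i} *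
        to_fract w"
proof -
  obtain w where w: "ceval z w \<noteq> 0"
    "(\<Prod>i<k. 1 - [:0, 1:] ^ (a + b * i)) =
        (1 - [:0, 1:] ^ d) ^ card {i \<in> {..<k}. d dvd a + b * i} * w"
    by (rule prod_one_minus_power_factor[OF prim d, of "{..<k}" "\<lambda>i. a + b * i"]) (use a in auto)
  have "qpoch (qvar ^ a) (qvar ^ b) k = to_fract (\<Prod>i<k. 1 - [:0, 1:] ^ (a + b * i))"
    by (simp add: qpoch_def to_fract_prod power_add power_mult)
  also have "\<dots> = (1 - qvar ^ d) ^ card {i. i < k \<and> d dvd a + b * i} * to_fract w"
    unfolding w by simp
  finally show ?thesis using that w(1) by blast
qed

lemma affine_cong_cancel:
  fixes a b d r s :: nat
  assumes "coprime b d" "r < d" "s < d" "(a + b * r) mod d = (a + b * s) mod d"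
  shows "r = s"
proof -
  have "[a + b * r = a + b * s] (mod d)" using assms(4) by (simp only: cong_def)
  then have "[b * r = b * s] (mod d)" by (simp only: cong_add_lcancel_nat)
  then have "[r = s] (mod d)" using assms(1) cong_mult_lcancel_nat by blast
  then show ?thesis using assms(2,3) by (simp add: cong_def)
qed

text \<open>On d consecutive indices i, the residues of a + b i modulo d form a permutation, so each
  block contributes one multiple.\<close>

lemma card_multiples_in_blocks:
  fixes a b d :: nat
  assumes cop: "coprime b d" and d: "d > 0"
  shows "card {i. i < j * d \<and> d dvd a + b * i} = j"
proof (induction j)
  case 0
  then show ?case by simp
next
  case (Suc j)
  define f where "f r = (a + b * r) mod d" for r
  have inj: "inj_on f {..<d}"
    by (rule inj_onI, rule affine_cong_cancel[OF cop]) (auto simp: f_def)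
  have "f ` {..<d} = {..<d}"
  proof (rule card_subset_eq)
    show "f ` {..<d} \<subseteq> {..<d}" unfolding f_def using d by (simp add: image_subset_iff)
    show "card (f ` {..<d}) = card {..<d}" by (rule card_image[OF inj])
  qed simp
  then have "0 \<in> f ` {..<d}" using d by simp
  then obtain r where r: "r < d" "f r = 0" by auto
  have dvd_iff: "d dvd a + b * (j * d + s) \<longleftrightarrow> f s = 0" for s
  proof -
    have "a + b * (j * d + s) = (a + b * s) + d * (b * j)" by (simp add: algebra_simps)
    then have "(a + b * (j * d + s)) mod d = f s" unfolding f_def by (simp only: mod_mult_self2)
    then show ?thesis by (simp only: dvd_eq_mod_eq_0)
  qed
  have "{i. i < Suc j * d \<and> d dvd a + b * i} = insert (j * d + r) {i. i < j * d \<and> d dvd a + b * i}"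
  proof (intro equalityI subsetI)
    fix i assume i: "i \<in> {i. i < Suc j * d \<and> d dvd a + b * i}"
    show "i \<in> insert (j * d + r) {i. i < j * d \<and> d dvd a + b * i}"
    proof (cases "i < j * d")
      case False
      define s where "s = i - j * d"
      have "i < j * d + d" using i by simp
      then have s: "i = j * d + s" "s < d" using False unfolding s_def by linarith+
      then have "f s = 0" using i dvd_iff by blast
      then have "s = r" using inj_onD[OF inj, of s r] r s by simp
      then show ?thesis using s by simp
    qed (use i in simp)
  next
    fix i assume "i \<in> insert (j * d + r) {i. i < j * d \<and> d dvd a + b * i}"
    then consider "i = j * d + r" | "i < j * d" "d dvd a + b * i" by blast
    then show "i \<in> {i. i < Suc j * d \<and> d dvd a + b * i}"
    proof cases
      case 1
      then show ?thesis using dvd_iff[of r] r by simp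
    next
      case 2
      then show ?thesis by simp
    qed
  qed
  moreover have "finite {i. i < j * d \<and> d dvd a + b * i}" by simp
  ultimately show ?case using Suc.IH by simp
qed

text \<open>The zero comes from 1 - q^n; the quotient of Pochhammer symbols must only be free of
  poles, which follows by matching multiples of d among its exponents.\<close>

lemma vanishes_qvalue:
  assumes prim: "z \<in> primitive_roots d" and dn: "d dvd n" and n: "odd n"
  shows "vanishes z 1 (qvalue qvar n)"
proof (cases "n mod 4 = 1")
  case True
  define m where "m = (n - 1) div 4"
  have npos: "n > 0" using n by (rule odd_pos)
  have d: "d > 0" "odd d" using dn n npos by (auto intro: dvd_pos_nat)
  have z0: "z \<noteq> 0" using primitive_roots_nonzero[OF prim d(1)] .
  obtain w1 where w1: "ceval z w1 \<noteq> 0"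
    "qpoch (qvar ^ 2) (qvar ^ 4) m = (1 - qvar ^ d) ^ card {i. i < m \<and> d dvd 2 + 4 * i} *
        to_fract w1"
    by (rule qpoch_factor[OF prim d(1), of 2]) auto
  obtain w2 where w2: "ceval z w2 \<noteq> 0"
    "qpoch (qvar ^ 4) (qvar ^ 4) m = (1 - qvar ^ d) ^ card {i. i < m \<and> d dvd 4 + 4 * i} *
        to_fract w2"
    by (rule qpoch_factor[OF prim d(1), of 4]) auto
  \<comment> \<open>With d = 2h + 1 one has 4 + 4i = (2 + 4(i - h)) + 2d, so i - h is the partner of
    i. The subtraction is not truncated, since d divides i + 1.\<close>
  obtain h where h: "d = 2 * h + 1" using d(2) by (elim oddE)
  have le: "card {i. i < m \<and> d dvd 4 + 4 * i} \<le> card {i. i < m \<and> d dvd 2 + 4 * i}"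
  proof (rule card_inj_on_le)
    have *: "d \<le> Suc i" if "d dvd 4 + 4 * i" for i
    proof -
      have "d dvd 4 * Suc i" using that by simp
      moreover have "coprime d 4" using d(2) coprime_power_right_iff[of d 2 2] by simp
      ultimately have "d dvd Suc i" by (simp only: coprime_dvd_mult_right_iff)
      then show ?thesis by (rule dvd_imp_le) simp
    qed
    show "inj_on (\<lambda>i. i - h) {i. i < m \<and> d dvd 4 + 4 * i}"
    proof (rule inj_onI)
      fix i j assume "i \<in> {i. i < m \<and> d dvd 4 + 4 * i}" "j \<in> {i. i < m \<and> d dvd 4 + 4 * i}"
          "i - h = j - h"
      then have "d \<le> Suc i" "d \<le> Suc j" "i - h = j - h" using * by auto
      then show "i = j" using h by linarith
    qed
    show "(\<lambda>i. i - h) ` {i. i < m \<and> d dvd 4 + 4 * i} \<subseteq> {i. i < m \<and> d dvd 2 + 4 * i}"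
    proof (rule image_subsetI)
      fix i assume "i \<in> {i. i < m \<and> d dvd 4 + 4 * i}"
      then have i: "i < m" "d dvd 4 + 4 * i" by simp_all
      have "2 + 4 * (i - h) + 2 * d = 4 + 4 * i" using *[OF i(2)] h by simp
      then have "d dvd 2 + 4 * (i - h) + 2 * d" using i(2) by (simp only:)
      then have "d dvd 2 + 4 * (i - h)" using dvd_add_left_iff[of d "2 * d"] dvd_triv_right by blast
      then show "i - h \<in> {i. i < m \<and> d dvd 2 + 4 * i}" using i by simp
    qed
  qed simp
  define s where "s = card {i. i < m \<and> d dvd 2 + 4 * i} - card {i. i < m \<and> d dvd 4 + 4 * i}"
  have s: "card {i. i < m \<and> d dvd 2 + 4 * i} = s + card {i. i < m \<and> d dvd 4 + 4 * i}"
    using le by (simp add: s_def)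
  have "w2 \<noteq> 0" using w2 by auto
  have "1 - qvar ^ d \<noteq> 0" using qvar_power_neq_1[OF d(1)] by simp
  then have q: "qpoch (qvar ^ 2) (qvar ^ 4) m / qpoch (qvar ^ 4) (qvar ^ 4) m =
      to_fract ((1 - [:0, 1:] ^ d) ^ s * w1) * (1 / to_fract w2)"
    unfolding w1 w2 s power_add by simp
  have zn: "z ^ n = 1" using primitive_roots_power_eq_1[OF prim d(1)] dn by simp
  have "qvalue qvar n = qpoch (qvar ^ 2) (qvar ^ 4) m / qpoch (qvar ^ 4) (qvar ^ 4) m *
      (1 - qvar ^ n) / qvar ^ m"
    using True by (simp add: qvalue_def m_def)
  also have "\<dots> = to_fract ((1 - [:0, 1:] ^ d) ^ s * w1) *
      (1 / to_fract w2 * (1 / qvar ^ m * (1 - qvar ^ n)))"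
    unfolding q by simp
  finally have "qvalue qvar n = to_fract ((1 - [:0, 1:] ^ d) ^ s * w1) *
      (1 / to_fract w2 * (1 / qvar ^ m * (1 - qvar ^ n)))" .
  then show ?thesis
    by (simp only:) (intro vanishes_mult_left vanishes_to_fract vanishes_inverse w2
        vanishes_inverse_qvar_power z0
        vanishes_one_minus_power zn)
qed (simp add: qvalue_def)

lemma qterm_1_eq:
  "qterm q 1 k = qpoch q (q ^ 4) k * qpoch q (q ^ 2) k ^ 3 * q ^ (k ^ 2 + k) /
     (qpoch (q ^ 2) (q ^ 2) k * qpoch (q ^ 4) (q ^ 4) k ^ 3)"
  by (simp add: qterm_def power3_eq_cube mult_ac)

text \<open>For such k the symbol (q;q^2)_k contains 1 - q^n and enters cubed, while k < n keeps the
  denominator nonzero at \<open>z\<close>. Hence the full and the half sum agree to order 3.\<close>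

lemma qterm_tail_vanishes:
  assumes prim: "z \<in> primitive_roots n" and n: "odd n" and k: "(n - 1) div 2 < k" "k < n"
  shows "vanishes z 3 (qterm qvar 1 k)"
proof -
  let ?X = "[:0, 1:] :: rat poly"
  have npos: "n > 0" using n by (rule odd_pos)
  have zn: "z ^ n = 1" using prim by (simp add: primitive_roots_def)
  obtain M where M: "n = 2 * M + 1" using n by (elim oddE)
  have "z * (z ^ 2) ^ M = 1" using zn by (simp add: M power_mult)
  then have "qpoch (z ^ 1) (z ^ 2) k = 0"
    unfolding qpoch_eq_0_iff using k by (intro exI[of _ M]) (simp add: M)
  then have v: "vanishes z 1 (to_fract (qpoch (?X ^ 1) (?X ^ 2) k))"
    by (intro vanishes_1_to_fract) (simp only: ceval_qpoch)
  define w where "w = qpoch (?X ^ 2) (?X ^ 2) k * qpoch (?X ^ 4) (?X ^ 4) k ^ 3"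
  have w: "ceval z w \<noteq> 0"
    using qpoch_primitive_root_neq_0[OF prim n k(2)]
    by (simp add: w_def ceval_qpoch)
  have "qterm qvar 1 k = (to_fract (qpoch (?X ^ 1) (?X ^ 4) k) *
      (1 / to_fract w * to_fract (?X ^ (k ^ 2 + k)))) * to_fract (qpoch (?X ^ 1) (?X ^ 2) k) ^ 3"
    unfolding qterm_1_eq w_def to_fract_mult to_fract_power[of "qpoch _ _ _"]
        qpoch_qvar[symmetric] by simp
  moreover have "vanishes z 3 (to_fract (qpoch (?X ^ 1) (?X ^ 2) k) ^ 3)"
    using vanishes_power[OF v, of 3] by simp
  ultimately show ?thesis
    by (simp only:) (intro vanishes_mult_left vanishes_to_fract vanishes_inverse w)
qed

lemma qsum_full_vanishes_3:
  assumes prim: "z \<in> primitive_roots n" and n: "odd n" "n \<ge> 3"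
  shows "vanishes z 3 (qsum qvar 1 n - qvalue qvar n)"
proof -
  define M where "M = (n - 1) div 2"
  have M: "Suc M \<le> n" using n by (auto simp: M_def)
  have "qsum qvar 1 n = qsum qvar 1 (Suc M) +
      (\<Sum>k = Suc M..<n. (1 - qvar ^ (6 * k + 1)) * qterm qvar 1 k)"
    unfolding qsum_def lessThan_atLeast0 by (rule sum.atLeastLessThan_concat[symmetric])
        (use M in auto)
  then have eq: "qsum qvar 1 n - qvalue qvar n = (qsum qvar 1 (Suc M) - qvalue qvar n) +
      (\<Sum>k = Suc M..<n. (1 - qvar ^ (6 * k + 1)) * qterm qvar 1 k)" by simp
  have "vanishes z 3 (qsum qvar 1 (Suc M) - qvalue qvar n)"
    by (rule qsum_vanishes_3[OF prim n M_def]) (rule vanishes_qvalue[OF prim dvd_refl n(1)])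
  moreover have "vanishes z 3 (\<Sum>k = Suc M..<n. (1 - qvar ^ (6 * k + 1)) * qterm qvar 1 k)"
  proof (rule vanishes_sum)
    fix k assume k: "k \<in> {Suc M..<n}"
    have "vanishes z 0 (1 - qvar ^ (6 * k + 1))"
      using vanishes_to_fract[of z "1 - [:0, 1:] ^ (6 * k + 1)"]
      by (simp only: to_fract_diff to_fract_1 to_fract_power)
    then show "vanishes z 3 ((1 - qvar ^ (6 * k + 1)) * qterm qvar 1 k)"
      by (rule vanishes_mult_left) (rule qterm_tail_vanishes[OF prim n(1)], use k in \<open>auto simp:
          M_def\<close>)
  qed
  ultimately show ?thesis unfolding eq by (rule vanishes_add)
qed

lemma qterm_1_add:
  "qterm q 1 (s + r) = qterm q 1 s *
     ((\<Prod>i<r. (1 - q ^ (4 * (s + i) + 1)) * (1 - q ^ (2 * (s + i) + 1)) ^ 3 *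
         q ^ (2 * (s + i) + 2)) /
      (\<Prod>i<r. (1 - q ^ (2 * (s + i) + 2)) * (1 - q ^ (4 * (s + i) + 4)) ^ 3))"
proof (induction r)
  case (Suc r)
  define k where "k = s + r"
  have pw: "q * (q ^ 4) ^ k = q ^ (4 * k + 1)" "q * (q ^ 2) ^ k = q ^ (2 * k + 1)"
    "q ^ 2 * (q ^ 2) ^ k = q ^ (2 * k + 2)" "q ^ 4 * (q ^ 4) ^ k = q ^ (4 * k + 4)"
    unfolding power_mult[symmetric] by (simp_all add: power_add) (simp add: power2_eq_square)
  have e: "(Suc k) ^ 2 + Suc k = (k ^ 2 + k) + (2 * k + 2)" by (simp add: power2_eq_square)
  have "qterm q 1 (Suc k) = qterm q 1 k *
      ((1 - q ^ (4 * k + 1)) * (1 - q ^ (2 * k + 1)) ^ 3 * q ^ (2 * k + 2) /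
       ((1 - q ^ (2 * k + 2)) * (1 - q ^ (4 * k + 4)) ^ 3))"
    unfolding qterm_1_eq qpoch_Suc pw e power_add[of q "k ^ 2 + k"] power_mult_distrib
        by (simp add: mult_ac)
  then show ?case
    using Suc.IH by (simp add: k_def)
qed simp

lemma power_mod_period:
  fixes z :: "'a::comm_ring_1"
  assumes "z ^ d = 1"
  shows "z ^ (c * (j * d + i) + e) = z ^ (c * i + e)"
proof -
  have "z ^ (c * (j * d + i) + e) = (z ^ d) ^ (c * j) * z ^ (c * i + e)"
    by (simp flip: power_mult power_add add: algebra_simps)
  then show ?thesis using assms by simp
qed

text \<open>The quotient of the terms jd + r and jd depends on j only through powers of q^{jd},
  which are 1 at \<open>z\<close>; there it agrees with the quotient for j = 0.\<close>

lemma qterm_block_cong: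
  assumes prim: "z \<in> primitive_roots d" and d: "odd d" and r: "r < d"
    and int: "vanishes z 0 (qterm qvar 1 (j * d))"
  shows "vanishes z 1 ((1 - qvar ^ (6 * (j * d + r) + 1)) * qterm qvar 1 (j * d + r) -
           qterm qvar 1 (j * d) * ((1 - qvar ^ (6 * r + 1)) * qterm qvar 1 r))"
proof -
  have dpos: "d > 0" using d by (rule odd_pos)
  have zd: "z ^ d = 1" using prim by (simp add: primitive_roots_def)
  define X :: "rat poly" where "X = [:0, 1:]"
  have evX: "ceval z X = z" by (simp add: X_def)
  have tX: "to_fract X = qvar" by (simp add: X_def)
  define u where "u s = (1 - X ^ (6 * (s + r) + 1)) *
     (\<Prod>i<r. (1 - X ^ (4 * (s + i) + 1)) * (1 - X ^ (2 * (s + i) + 1)) ^ 3 *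
         X ^ (2 * (s + i) + 2))" for s
  define v where "v s = (\<Prod>i<r. (1 - X ^ (2 * (s + i) + 2)) * (1 - X ^ (4 * (s + i) + 4)) ^ 3)" for s
  have term_eq: "(1 - qvar ^ (6 * (s + r) + 1)) * qterm qvar 1 (s + r) =
      qterm qvar 1 s * (to_fract (u s) / to_fract (v s))" for s
    unfolding qterm_1_add[of qvar s r] u_def v_def
    by (simp only: to_fract_mult to_fract_prod to_fract_diff to_fract_1 to_fract_power tX
        times_divide_eq_right mult_ac)
  have t0: "qterm qvar 1 0 = 1" by (simp add: qterm_def)
  have evu: "ceval z (u (j * d)) = ceval z (u 0)"
    unfolding u_def by (simp only: ceval_simps ceval_power ceval_prod evX power_mod_period[OF zd]
        add_0)
  have evv: "ceval z (v (j * d)) = ceval z (v 0)"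
    unfolding v_def by (simp only: ceval_simps ceval_power ceval_prod evX power_mod_period[OF zd]
        add_0)
  have v0: "ceval z (v 0) \<noteq> 0"
  proof -
    have "z ^ (2 * i + 2) \<noteq> 1" "z ^ (4 * i + 4) \<noteq> 1" if "i < r" for i
    proof -
      have "\<not> d dvd Suc i" using that r by (auto dest!: dvd_imp_le)
      moreover have "coprime d 2" "coprime d 4" using d coprime_power_right_iff[of d 2 2]
          by simp_all
      ultimately have "\<not> d dvd 2 * Suc i" "\<not> d dvd 4 * Suc i"
        by (simp_all only: coprime_dvd_mult_right_iff not_False_eq_True)
      then show "z ^ (2 * i + 2) \<noteq> 1" "z ^ (4 * i + 4) \<noteq> 1"
        unfolding primitive_roots_power_eq_1[OF prim dpos] by (simp_all add: add.commute)
    qed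
    then show ?thesis
      unfolding v_def by (auto simp: ceval_prod evX simp del: power_Suc add_2_eq_Suc')
  qed
  have "v s \<noteq> 0" if "ceval z (v s) \<noteq> 0" for s using that by auto
  then have nz: "v 0 \<noteq> 0" "v (j * d) \<noteq> 0" using v0 evv by auto
  have "to_fract (u (j * d)) / to_fract (v (j * d)) - to_fract (u 0) / to_fract (v 0) =
      to_fract (u (j * d) * v 0 - u 0 * v (j * d)) / to_fract (v (j * d) * v 0)"
    using nz by (simp add: field_simps)
  also have "vanishes z 1 \<dots>"
  proof -
    have "ceval z (u (j * d) * v 0 - u 0 * v (j * d)) = 0" by (simp add: evu evv)
    then have "vanishes z 1 (to_fract (u (j * d) * v 0 - u 0 * v (j * d)))"
        by (rule vanishes_1_to_fract)
    moreover have "ceval z (v (j * d) * v 0) \<noteq> 0" using v0 evv by simp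
    ultimately have "vanishes z 1 (1 / to_fract (v (j * d) * v 0) *
        to_fract (u (j * d) * v 0 - u 0 * v (j * d)))"
      by (intro vanishes_mult_left vanishes_inverse)
    then show ?thesis by simp
  qed
  finally have "vanishes z 1 (qterm qvar 1 (j * d) *
      (to_fract (u (j * d)) / to_fract (v (j * d)) - to_fract (u 0) / to_fract (v 0)))"
    by (rule vanishes_mult_left[OF int])
  then show ?thesis
    using term_eq[of "j * d"] term_eq[of 0] by (simp add: t0 right_diff_distrib)
qed

text \<open>Over j full blocks each Pochhammer symbol has exactly j exponents divisible by d.
  Counted with multiplicity there are four symbols above and four below, so all powers of 1 - q^d
  cancel.\<close>

lemma vanishes_qterm_block_start:
  assumes prim: "z \<in> primitive_roots d" and d: "odd d"
  shows "vanishes z 0 (qterm qvar 1 (j * d))"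
proof -
  have dpos: "d > 0" using d by (rule odd_pos)
  have cop: "coprime 2 d" "coprime 4 d"
    using d coprime_power_left_iff[of 2 2 d] by simp_all
  let ?Y = "1 - qvar ^ d"
  have fac: "\<exists>w. ceval z w \<noteq> 0 \<and> qpoch (qvar ^ a) (qvar ^ b) (j * d) = ?Y ^ j * to_fract w"
    if "a > 0" "b = 2 \<or> b = 4" for a b
  proof -
    have "coprime b d" using that cop by auto
    then have count: "card {i. i < j * d \<and> d dvd a + b * i} = j"
      using dpos by (rule card_multiples_in_blocks)
    show ?thesis
      by (rule qpoch_factor[OF prim dpos that(1), of b "j * d"]) (auto simp: count)
  qed
  obtain w1 where w1: "ceval z w1 \<noteq> 0" "qpoch (qvar ^ 1) (qvar ^ 4) (j * d) = ?Y ^ j * to_fract w1"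
    using fac[of 1 4] by auto
  obtain w2 where w2: "ceval z w2 \<noteq> 0" "qpoch (qvar ^ 1) (qvar ^ 2) (j * d) = ?Y ^ j * to_fract w2"
    using fac[of 1 2] by auto
  obtain w3 where w3: "ceval z w3 \<noteq> 0" "qpoch (qvar ^ 2) (qvar ^ 2) (j * d) = ?Y ^ j * to_fract w3"
    using fac[of 2 2] by auto
  obtain w4 where w4: "ceval z w4 \<noteq> 0" "qpoch (qvar ^ 4) (qvar ^ 4) (j * d) = ?Y ^ j * to_fract w4"
    using fac[of 4 4] by auto
  define y where "y = ?Y ^ j"
  have y: "y \<noteq> 0" using qvar_power_neq_1[OF dpos] by (simp add: y_def)
  define e where "e = (j * d) ^ 2 + j * d"
  have "qterm qvar 1 (j * d) =
      y * to_fract w1 * (y * to_fract w2) ^ 3 * qvar ^ e /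
          (y * to_fract w3 * (y * to_fract w4) ^ 3)"
    unfolding qterm_1_eq e_def using w1(2) w2(2) w3(2) w4(2) by (simp add: y_def)
  also have "\<dots> = to_fract w1 * (to_fract w2 ^ 3 * (qvar ^ e * (1 / to_fract (w3 * w4 ^ 3))))"
    using y by (simp add: power_mult_distrib)
  also have "\<dots> = to_fract (w1 * (w2 ^ 3 * [:0, 1:] ^ e)) * (1 / to_fract (w3 * w4 ^ 3))"
    by (simp only: to_fract_mult to_fract_power mult_ac)
  finally show ?thesis
    by (simp only:) (intro vanishes_mult_left vanishes_to_fract vanishes_inverse, use w3 w4 in simp)
qed

lemma qsum_add: "qsum q a (m + N) = qsum q a m +
    (\<Sum>r<N. (1 - q ^ (6 * (m + r) + 1)) * qterm q a (m + r))"
  by (induction N) (simp_all add: qsum_def)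

lemma qsum_vanishes_blocks:
  assumes prim: "z \<in> primitive_roots d" and d: "odd d" and N: "N \<le> d"
    and full: "vanishes z 1 (qsum qvar 1 d)" and part: "vanishes z 1 (qsum qvar 1 N)"
  shows "vanishes z 1 (qsum qvar 1 (J * d + N))"
proof -
  have block: "vanishes z 1 (\<Sum>r<K. (1 - qvar ^ (6 * (j * d + r) + 1)) * qterm qvar 1 (j * d + r))"
    if K: "K \<le> d" "vanishes z 1 (qsum qvar 1 K)" for K j
  proof -
    note int = vanishes_qterm_block_start[OF prim d, of j]
    have eq: "(\<Sum>r<K. (1 - qvar ^ (6 * (j * d + r) + 1)) * qterm qvar 1 (j * d + r)) =
      (\<Sum>r<K. (1 - qvar ^ (6 * (j * d + r) + 1)) * qterm qvar 1 (j * d + r) -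
           qterm qvar 1 (j * d) * ((1 - qvar ^ (6 * r + 1)) * qterm qvar 1 r)) +
      qterm qvar 1 (j * d) * qsum qvar 1 K"
      unfolding qsum_def sum_distrib_left sum_subtractf by simp
    have "vanishes z 1 (\<Sum>r<K. (1 - qvar ^ (6 * (j * d + r) + 1)) * qterm qvar 1 (j * d + r) -
           qterm qvar 1 (j * d) * ((1 - qvar ^ (6 * r + 1)) * qterm qvar 1 r))"
      by (rule vanishes_sum, rule qterm_block_cong[OF prim d _ int]) (use K in auto)
    then show ?thesis
      unfolding eq by (rule vanishes_add) (rule vanishes_mult_left[OF int K(2)])
  qed
  have "vanishes z 1 (qsum qvar 1 (J * d))"
  proof (induction J)
    case 0
    then show ?case by (simp add: qsum_def)
  next
    case (Suc J)
    have "qsum qvar 1 (Suc J * d) = qsum qvar 1 (J * d + d)" by (simp add: add.commute)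
    then show ?case unfolding qsum_add using vanishes_add[OF Suc block[OF order_refl full, of J]]
        by simp
  qed
  then show ?thesis unfolding qsum_add by (rule vanishes_add) (rule block[OF N part])
qed

text \<open>To first order the two sides need no comparison: each vanishes at \<open>z\<close> by
  itself.\<close>

lemma qsum_vanishes_1:
  assumes prim: "z \<in> primitive_roots d" and dn: "d dvd n" and n: "odd n" and d1: "d > 1"
    and K: "K = n \<or> K = Suc ((n - 1) div 2)"
  shows "vanishes z 1 (qsum qvar 1 K - qvalue qvar n)"
proof -
  obtain e where e: "n = d * e" using dn by (elim dvdE)
  have odd: "odd d" "odd e" using n e by auto
  then have d3: "d \<ge> 3" using d1 by (auto elim!: oddE)
  define M where "M = (d - 1) div 2"
  have dM: "d = 2 * M + 1" using odd by (auto simp: M_def elim!: oddE)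
  have val: "vanishes z 1 (qvalue qvar d)" by (rule vanishes_qvalue[OF prim dvd_refl odd(1)])
  have full: "vanishes z 1 (qsum qvar 1 d)"
    using vanishes_add[OF vanishes_mono[OF qsum_full_vanishes_3[OF prim odd(1) d3], of 1] val]
        by simp
  have half: "vanishes z 1 (qsum qvar 1 (Suc M))"
    using vanishes_add[OF vanishes_mono[OF qsum_vanishes_3[OF prim odd(1) d3 M_def val], of 1]
        val] by simp
  have "vanishes z 1 (qsum qvar 1 K)"
    using K
  proof
    assume "K = n"
    then have "K = e * d + 0" using e by simp
    moreover have "vanishes z 1 (qsum qvar 1 0)" by (simp add: qsum_def)
    ultimately show ?thesis using qsum_vanishes_blocks[OF prim odd(1) _ full, of 0 e] by simp
  next
    assume "K = Suc ((n - 1) div 2)"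
    moreover obtain c where c: "e = 2 * c + 1" using odd(2) by (elim oddE)
    \<comment> \<open>As e = 2c + 1 and d = 2M + 1, the half range for n consists of c full blocks
      followed by exactly the half range for d.\<close>
    moreover have "n = 2 * (c * d + M) + 1" using e c dM by (simp add: algebra_simps)
    ultimately have "K = c * d + Suc M" by simp
    moreover have "Suc M \<le> d" using dM d3 by simp
    ultimately show ?thesis using qsum_vanishes_blocks[OF prim odd(1) _ full half, of c]
        by (simp only:)
  qed
  then show ?thesis by (rule vanishes_diff) (rule vanishes_qvalue[OF prim dn n])
qed

text \<open>Dividing by 1 - q costs nothing away from z = 1, and for n > 1 the point 1 is not a zero
  of the modulus. For n = 1 the two sides are equal.\<close>

lemma ratfun_cong_qsum:
  assumes n: "odd n" and K: "K = n \<or> K = Suc ((n - 1) div 2)"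
  shows "ratfun_cong (qsum qvar 1 K / (1 - qvar)) (qvalue qvar n / (1 - qvar))
           (qint n * to_fract (cyclotomic n) ^ 2)"
proof (cases "n = 1")
  case True
  then have "qsum qvar 1 K = qvalue qvar n"
    using K by (auto simp: qsum_def qvalue_def qterm_def)
  then show ?thesis
    unfolding ratfun_cong_def using True
    by (intro exI[of _ "cyclotomic 1 ^ 2"] exI[of _ 0] exI[of _ 1])
       (simp add: qint_conv_to_fract Fract_conv_to_fract)
next
  case False
  then have n1: "n > 1" using n by (auto elim!: oddE)
  have npos: "n > 0" using n1 by simp
  have n3: "n \<ge> 3" using n n1 by (auto elim!: oddE)
  have scale: "vanishes z k (qsum qvar 1 K / (1 - qvar) - qvalue qvar n / (1 - qvar))"
    if "vanishes z k (qsum qvar 1 K - qvalue qvar n)" "z \<noteq> 1" for z k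
  proof -
    have "ceval z (1 - [:0, 1:]) \<noteq> 0" using that(2) by simp
    from vanishes_mult_left[OF vanishes_inverse[OF this] that(1)]
    show ?thesis by (simp add: diff_divide_distrib)
  qed
  show ?thesis
  proof (rule ratfun_cong_if_vanishes[OF n1])
    fix z :: complex assume z: "z ^ n = 1" "z \<noteq> 1"
    then have "z \<in> (\<Union>d \<in> {d. d dvd n}. primitive_roots d)"
      using roots_of_unity_partition[OF npos] by blast
    then obtain d where d: "d dvd n" "z \<in> primitive_roots d" by blast
    have "d \<noteq> 1" using d z by (auto simp: primitive_roots_def)
    moreover have "d > 0" using d npos by (auto intro: dvd_pos_nat)
    ultimately have "d > 1" by simp
    then show "vanishes z 1 (qsum qvar 1 K / (1 - qvar) - qvalue qvar n / (1 - qvar))"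
      by (intro scale qsum_vanishes_1[OF d(2,1) n _ K] z)
  next
    fix z assume prim: "z \<in> primitive_roots n"
    have "z \<noteq> 1" using prim n1 by (auto simp: primitive_roots_def)
    moreover have "vanishes z 3 (qsum qvar 1 K - qvalue qvar n)"
      using K qsum_full_vanishes_3[OF prim n n3]
        qsum_vanishes_3[OF prim n n3 refl vanishes_qvalue[OF prim dvd_refl n]] by auto
    ultimately show "vanishes z 3 (qsum qvar 1 K / (1 - qvar) - qvalue qvar n / (1 - qvar))"
      by (intro scale)
  qed
qed

theorem theorem1:
  fixes n :: nat
  assumes "n > 0" and "odd n"
  shows
    "ratfun_cong
       (\<Sum>k = 0..(n - 1) div 2.
          qint (6 * k + 1) *
          (qpoch qvar (qvar ^ 4) k * qpoch qvar (qvar ^ 2) k ^ 3 /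
           (qpoch (qvar ^ 2) (qvar ^ 2) k * qpoch (qvar ^ 4) (qvar ^ 4) k ^ 3)) *
          qvar ^ (k ^ 2 + k))
       (if n mod 4 = 1
        then qpoch (qvar ^ 2) (qvar ^ 4) ((n - 1) div 4) / qpoch (qvar ^ 4) (qvar ^ 4) ((n - 1) div 4) *
             qint n * qvar powi ((1 - int n) div 4)
        else 0)
       (qint n * to_fract (cyclotomic n) ^ 2)
     \<and>
     ratfun_cong
       (\<Sum>k = 0..n - 1.
          qint (6 * k + 1) *
          (qpoch qvar (qvar ^ 4) k * qpoch qvar (qvar ^ 2) k ^ 3 /
           (qpoch (qvar ^ 2) (qvar ^ 2) k * qpoch (qvar ^ 4) (qvar ^ 4) k ^ 3)) *
          qvar ^ (k ^ 2 + k))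
       (if n mod 4 = 1
        then qpoch (qvar ^ 2) (qvar ^ 4) ((n - 1) div 4) / qpoch (qvar ^ 4) (qvar ^ 4) ((n - 1) div 4) *
             qint n * qvar powi ((1 - int n) div 4)
        else 0)
       (qint n * to_fract (cyclotomic n) ^ 2)"
proof -
  have lhs: "(\<Sum>k = 0..m.
          qint (6 * k + 1) *
          (qpoch qvar (qvar ^ 4) k * qpoch qvar (qvar ^ 2) k ^ 3 /
           (qpoch (qvar ^ 2) (qvar ^ 2) k * qpoch (qvar ^ 4) (qvar ^ 4) k ^ 3)) *
          qvar ^ (k ^ 2 + k)) = qsum qvar 1 (Suc m) / (1 - qvar)" for m
    unfolding qsum_def sum_divide_distrib lessThan_Suc_atMost atMost_atLeast0
    by (intro sum.cong refl) (simp add: qterm_1_eq qint_def mult_ac del: power_Suc)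
  have rhs: "(if n mod 4 = 1
        then qpoch (qvar ^ 2) (qvar ^ 4) ((n - 1) div 4) /
            qpoch (qvar ^ 4) (qvar ^ 4) ((n - 1) div 4) *
             qint n * qvar powi ((1 - int n) div 4)
        else 0) = qvalue qvar n / (1 - qvar)"
  proof (cases "n mod 4 = 1")
    case True
    define m where "m = n div 4"
    have nm: "n = 4 * m + 1" using True unfolding m_def by presburger
    \<comment> \<open>The integer division is exact: 1 - n = -4m.\<close>
    have "(1 - int n) div 4 = - int m" by (simp add: nm)
    then have "qvar powi ((1 - int n) div 4) = 1 / qvar ^ m"
      by (simp add: power_int_minus field_simps)
    moreover have "(n - 1) div 4 = m" by (simp add: nm)
    ultimately show ?thesis using True by (simp add: qvalue_def qint_def)
  qed (simp add: qvalue_def)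
  have "Suc (n - 1) = n" using assms by simp
  then show ?thesis
    unfolding lhs rhs using ratfun_cong_qsum[OF assms(2)] by simp
qed

end
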